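(* Let $F:\mathbb{R}^n\to\mathbb{R}\cup\{\infty\}$ be closed and level-bounded, let $x^*$ be a Clarke critical point of $F$ (i.e. $0\in\partial_c F(x^* )$), and suppose that $F$ admits a $\mathcal{C}^3$-active manifold $\mathcal{M}$ at $x^*$. Let $s:\mathbb{R}^n\times\mathbb{R}^n\to\mathbb{R}\cup\{\infty\}$ and suppose that an algorithm generates a sequence $x^k\to x^*$ by $$x^{k+1}=H(x^k),\qquad H(x):=\operatorname*{arg\,min}_{y\in\mathbb{R}^n}s(x,y),$$ where $H:\mathbb{R}^n\to\mathbb{R}^n$ is continuous. Assume that: (a) $s$ inherits the $\mathcal{C}^3$-smoothness of $F$ on $\mathcal{M}$ near $x^*$: there is a function $\hat s$, $\mathcal{C}^3$-smooth in a neighborhood of $(x^*,x^* )$, with $\hat s(x,y)=s(x,y)$ for all $x$ near $x^*$ and all $y\in\mathcal{M}$ near $x^*$; (b) $H(x)$ is the unique global minimizer of $s(x,\cdot)$ and is a strong minimizer of $s(x,\cdot)$; (c) the algorithm identifies $\mathcal{M}$: $H(x)\in\mathcal{M}$ for all $x$ near $x^*$. Then: (i) $H$ is $\mathcal{C}^2$-smooth near $x^*$, and both $H$ and $\nabla H$ are Lipschitz continuous near $x^*$. (ii) Suppose in addition that there are $\rho>0$ and $\gamma\in(0,1)$ with $\|H(x)-H(y)\|\le\gamma\|x-y\|$ for all $x,y$ in the closed ball $\mathcal{B}_{x^*}(\rho)$, and that there is a constant $M_\alpha$ such that the Anderson acceleration coefficients satisfy $\sum_{i=0}^{m_k}|\alpha^k_i|\le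 M_\alpha$ for all $k\in\mathbb{N}$. Then, if the initial point $x^0$ is sufficiently close to $x^*$, the iterates $\{x^k\}$ produced by Anderson acceleration (memory $m\ge1$) applied to $H$ from $x^0$ converge to $x^*$ R-linearly with some $\hat\gamma\in(\gamma,1)$; namely, for all $k\ge 0$, $$\|H(x^k)-x^k\|\le\hat\gamma^k\|H(x^0)-x^0\|\quad\text{and}\quad\|x^k-x^*\|\le\frac{1+\gamma}{1-\gamma}\,\hat\gamma^k\|x^0-x^*\|.$$
   Context: $\|\cdot\|$ is the Euclidean norm; $\mathcal{B}_x(\rho)$ and $\hat{\mathcal{B}}_x(\rho)$ are the closed and open balls of radius $\rho$ around $x$. Subdifferentials. For a set $Q$ and $x\in Q$, the regular normal cone is $N_Q(x)=\{\nu:\limsup_{y\to x,\,y\in Q}\langle\nu,y-x\rangle/\|y-x\|\le0\}$; the limiting normal cone consists of all limits of $\nu_i\in N_Q(x_i)$ with $x_i\in Q$, $x_i\to x$; the Clarke normal cone $N^c_Q(x)$ is the closed convex hull of the limiting normal cone. For $f$ finite at $x$, $\partial f(x)=\{\nu:(\nu,-1)\in N_{\mathrm{epi} f}(x,f(x))\}$ and $\partial_cf(x)=\{\nu:(\nu,-1)\in N^c_{\mathrm{epi} f}(x,f(x))\}$. The function $f$ is regular at $x$ if $\mathrm{epi} f$ is locally closed around $(x,f(x))$ and $N_{\mathrm{epi} f}(x,f(x))=N^c_{\mathrm{epi} f}(x,f(x))$. The subderivative is $df(x)(\bar\nu)=\liminf_{\tau\downarrow0,\ \nu\to\bar\nu}\frac{f(x+\tau\nu)-f(x)}{\tau}$.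 Smooth manifold. $\mathcal{M}\subset\mathbb{R}^n$ is a $\mathcal{C}^p$-smooth manifold of dimension $r$ around $\bar x\in\mathcal{M}$ if there are $\epsilon>0$ and a $\mathcal{C}^p$-smooth $G:\mathbb{R}^n\to\mathbb{R}^{n-r}$ with $\nabla G(\bar x)$ of full row rank and $\mathcal{M}\cap\hat{\mathcal{B}}_{\bar x}(\epsilon)=\{x\in\hat{\mathcal{B}}_{\bar x}(\epsilon):G(x)=0\}$. Tangent and normal spaces: $T_{\mathcal{M}}(x)=\ker\nabla G(x)$, $N_{\mathcal{M}}(x)=T_{\mathcal{M}}(x)^\perp$. Active manifold. A closed function $f$ admits a $\mathcal{C}^p$-active manifold $\mathcal{M}\ni\bar x$ at $\bar x$ (equivalently, $f$ is partly smooth at $\bar x$ relative to $\mathcal{M}$) if: (1) near $\bar x$, $\mathcal{M}$ is a $\mathcal{C}^p$-smooth manifold and the restriction of $f$ to $\mathcal{M}$ is $\mathcal{C}^p$-smooth; (2) for all $x\in\mathcal{M}$ near $\bar x$, $f$ is regular at $x$ and has a subgradient there; (3) $df(\bar x)(-\nu)>-df(\bar x)(\nu)$ for all nonzero $\nu\in N_{\mathcal{M}}(\bar x)$; (4) the set-valued map $\partial_cf$ is continuous at $\bar x$ relative to $\mathcal{M}$. Strong minimizer. $\bar y$ is a strong (local) minimizer of $\varphi$ if there is $c>0$ such that $\varphi(y)\ge\varphi(\bar y)+c\|y-\bar y\|^2$ for all $y$ near $\bar y$. Anderson acceleration with memory $m\ge1$ for a mapping $H$, started at $x^0$: put $H^k=H(x^k)$,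 $r^k=H^k-x^k$, $m_k=\min(m,k)$. For $k=0,1,2,\dots$ let $\alpha^k=(\alpha^k_0,\dots,\alpha^k_{m_k})$ be a minimizer of $\big\|\sum_{i=0}^{m_k}\alpha_i r^{k-m_k+i}\big\|^2$ over $\alpha\in\mathbb{R}^{m_k+1}$ with $\sum_i\alpha_i=1$, and set $x^{k+1}=\sum_{i=0}^{m_k}\alpha^k_iH^{k-m_k+i}$. "Sufficiently close" may depend on $M_\alpha$, $m$ and $H$. *)

theory Defs
  imports "HOL-Analysis.Analysis"
begin

section \<open>Smoothness of finite order\<close>

text \<open>Meant for open \<open>S\<close>. A map is \<open>C\<^sup>k\<^sup>+\<^sup>1\<close> iff it is differentiable and every directional derivative
  is \<open>C\<^sup>k\<close>; in finite dimensions this is continuity of all derivatives up to order \<open>k + 1\<close>.\<close>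

primrec Ck_on :: "nat \<Rightarrow> 'a::real_normed_vector set \<Rightarrow> ('a \<Rightarrow> 'b::real_normed_vector) \<Rightarrow> bool" where
  "Ck_on 0 S f \<longleftrightarrow> continuous_on S f"
| "Ck_on (Suc k) S f \<longleftrightarrow>
     (\<forall>x\<in>S. f differentiable (at x)) \<and>
     (\<forall>v. Ck_on k S (\<lambda>x. frechet_derivative f (at x) v))"

section \<open>Normal cones and subdifferentials\<close>

text \<open>All normal cones at a point outside the set, and both subdifferentials at a point where the
  function is not finite, are empty.\<close>

definition regular_normal_cone :: "'a::real_inner set \<Rightarrow> 'a \<Rightarrow> 'a set" where
  "regular_normal_cone Q x =
     {\<nu>. x \<in> Q \<and> Limsup (at x within Q) (\<lambda>y. ereal (\<nu> \<bullet> (y - x) / norm (y - x))) \<le> 0}"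

definition limiting_normal_cone :: "'a::real_inner set \<Rightarrow> 'a \<Rightarrow> 'a set" where
  "limiting_normal_cone Q x =
     {\<nu>. x \<in> Q \<and> (\<exists>X V. (\<forall>i::nat. X i \<in> Q \<and> V i \<in> regular_normal_cone Q (X i)) \<and>
           X \<longlonglongrightarrow> x \<and> V \<longlonglongrightarrow> \<nu>)}"

definition clarke_normal_cone :: "'a::real_inner set \<Rightarrow> 'a \<Rightarrow> 'a set" where
  "clarke_normal_cone Q x = closure (convex hull (limiting_normal_cone Q x))"

text \<open>Extended-real-valued version of \<^const>\<open>epigraph\<close>.\<close>

definition epi :: "('a \<Rightarrow> ereal) \<Rightarrow> ('a \<times> real) set" where
  "epi f = {(x, t). f x \<le> ereal t}"

definition finite_at :: "('a \<Rightarrow> ereal) \<Rightarrow> 'a \<Rightarrow> bool" where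
  "finite_at f x \<longleftrightarrow> \<bar>f x\<bar> \<noteq> \<infinity>"

definition regular_subdiff :: "('a::real_inner \<Rightarrow> ereal) \<Rightarrow> 'a \<Rightarrow> 'a set" where
  "regular_subdiff f x =
     {\<nu>. finite_at f x \<and> (\<nu>, -1) \<in> regular_normal_cone (epi f) (x, real_of_ereal (f x))}"

definition clarke_subdiff :: "('a::real_inner \<Rightarrow> ereal) \<Rightarrow> 'a \<Rightarrow> 'a set" where
  "clarke_subdiff f x =
     {\<nu>. finite_at f x \<and> (\<nu>, -1) \<in> clarke_normal_cone (epi f) (x, real_of_ereal (f x))}"

definition locally_closed_at :: "'a::metric_space set \<Rightarrow> 'a \<Rightarrow> bool" where
  "locally_closed_at Q z \<longleftrightarrow> (\<exists>\<epsilon>>0. closed (Q \<inter> cball z \<epsilon>))"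

definition regular_at :: "('a::real_inner \<Rightarrow> ereal) \<Rightarrow> 'a \<Rightarrow> bool" where
  "regular_at f x \<longleftrightarrow>
     finite_at f x \<and>
     locally_closed_at (epi f) (x, real_of_ereal (f x)) \<and>
     regular_normal_cone (epi f) (x, real_of_ereal (f x)) =
       clarke_normal_cone (epi f) (x, real_of_ereal (f x))"

definition subderivative :: "('a::real_normed_vector \<Rightarrow> ereal) \<Rightarrow> 'a \<Rightarrow> 'a \<Rightarrow> ereal" where
  "subderivative f x \<nu> =
     Liminf (at_right 0 \<times>\<^sub>F nhds \<nu>) (\<lambda>(\<tau>, w). (f (x + \<tau> *\<^sub>R w) - f x) / ereal \<tau>)"

section \<open>Set-valued continuity\<close>

text \<open>Painleve--Kuratowski continuity of a set-valued map at \<open>x\<close> relative to \<open>M\<close>, in terms of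
  sequences: the first conjunct is outer, the second inner semicontinuity.\<close>

definition set_valued_continuous_at ::
  "('a::topological_space \<Rightarrow> 'b::topological_space set) \<Rightarrow> 'a set \<Rightarrow> 'a \<Rightarrow> bool" where
  "set_valued_continuous_at S M x \<longleftrightarrow>
     (\<forall>X V v. (\<forall>i::nat. X i \<in> M \<and> V i \<in> S (X i)) \<and> X \<longlonglongrightarrow> x \<and> V \<longlonglongrightarrow> v \<longrightarrow> v \<in> S x) \<and>
     (\<forall>v\<in>S x. \<forall>X. (\<forall>i::nat. X i \<in> M) \<and> X \<longlonglongrightarrow> x \<longrightarrow>
        (\<exists>V. (\<forall>\<^sub>F i in sequentially. V i \<in> S (X i)) \<and> V \<longlonglongrightarrow> v))"

section \<open>Smooth manifolds and active manifolds\<close>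

text \<open>A map \<open>G\<close> from \<open>\<real>\<^sup>n\<close> to \<open>\<real>\<^sup>n\<^sup>-\<^sup>r\<close> is given by its real components \<open>G i\<close>, \<open>i < n - r\<close>, and full row
  rank of its Jacobian is linear independence of the component derivatives.\<close>

definition full_row_rank_at :: "nat \<Rightarrow> (nat \<Rightarrow> 'a::real_normed_vector \<Rightarrow> real) \<Rightarrow> 'a \<Rightarrow> bool" where
  "full_row_rank_at q G x \<longleftrightarrow>
     (\<forall>c :: nat \<Rightarrow> real.
        (\<forall>v. (\<Sum>i<q. c i * frechet_derivative (G i) (at x) v) = 0) \<longrightarrow> (\<forall>i<q. c i = 0))"

definition manifold_around ::
  "nat \<Rightarrow> nat \<Rightarrow> 'a::euclidean_space set \<Rightarrow> 'a \<Rightarrow> (nat \<Rightarrow> 'a \<Rightarrow> real) \<Rightarrow> bool" where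
  "manifold_around p r M x G \<longleftrightarrow>
     x \<in> M \<and> r \<le> DIM('a) \<and>
     (\<forall>i < DIM('a) - r. Ck_on p UNIV (G i)) \<and>
     full_row_rank_at (DIM('a) - r) G x \<and>
     (\<exists>\<epsilon>>0. M \<inter> ball x \<epsilon> = {y \<in> ball x \<epsilon>. \<forall>i < DIM('a) - r. G i y = 0})"

definition tangent_space ::
  "nat \<Rightarrow> (nat \<Rightarrow> 'a::euclidean_space \<Rightarrow> real) \<Rightarrow> 'a \<Rightarrow> 'a set" where
  "tangent_space r G x = {v. \<forall>i < DIM('a) - r. frechet_derivative (G i) (at x) v = 0}"

definition normal_space ::
  "nat \<Rightarrow> (nat \<Rightarrow> 'a::euclidean_space \<Rightarrow> real) \<Rightarrow> 'a \<Rightarrow> 'a set" where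
  "normal_space r G x = (tangent_space r G x)\<^sup>\<bottom>"

definition restriction_smooth_near ::
  "nat \<Rightarrow> ('a::real_normed_vector \<Rightarrow> ereal) \<Rightarrow> 'a set \<Rightarrow> 'a \<Rightarrow> bool" where
  "restriction_smooth_near p f M x \<longleftrightarrow>
     (\<exists>\<epsilon>>0. \<exists>g :: 'a \<Rightarrow> real. Ck_on p (ball x \<epsilon>) g \<and> (\<forall>y \<in> M \<inter> ball x \<epsilon>. f y = ereal (g y)))"

text \<open>The dimension \<open>r\<close> and the defining map \<open>G\<close> are not part of the data: the tangent space at
  \<open>x\<close> does not depend on their choice.\<close>

definition admits_active_manifold ::
  "nat \<Rightarrow> ('a::euclidean_space \<Rightarrow> ereal) \<Rightarrow> 'a set \<Rightarrow> 'a \<Rightarrow> bool" where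
  "admits_active_manifold p f M x \<longleftrightarrow>
     (\<exists>r G.
        manifold_around p r M x G \<and>
        restriction_smooth_near p f M x \<and>
        (\<exists>\<epsilon>>0. \<forall>y \<in> M \<inter> ball x \<epsilon>. regular_at f y \<and> regular_subdiff f y \<noteq> {}) \<and>
        (\<forall>\<nu> \<in> normal_space r G x. \<nu> \<noteq> 0 \<longrightarrow> subderivative f x (- \<nu>) > - subderivative f x \<nu>) \<and>
        set_valued_continuous_at (clarke_subdiff f) M x)"

section \<open>Minimizers\<close>

definition level_bounded :: "('a::metric_space \<Rightarrow> ereal) \<Rightarrow> bool" where
  "level_bounded f \<longleftrightarrow> (\<forall>a::real. bounded {x. f x \<le> ereal a})"

definition argmin_set :: "('a \<Rightarrow> ereal) \<Rightarrow> 'a set" where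
  "argmin_set \<phi> = {y. \<forall>z. \<phi> y \<le> \<phi> z}"

definition strong_minimizer :: "('a::real_normed_vector \<Rightarrow> ereal) \<Rightarrow> 'a \<Rightarrow> bool" where
  "strong_minimizer \<phi> y \<longleftrightarrow>
     (\<exists>c>0. \<forall>\<^sub>F z in nhds y. \<phi> z \<ge> \<phi> y + ereal (c * (norm (z - y))\<^sup>2))"

section \<open>Anderson acceleration\<close>

text \<open>\<open>anderson m H x \<alpha>\<close>: the sequence \<open>x\<close>, with coefficients \<open>\<alpha> k i\<close> for \<open>i \<le> min m k\<close>, is a run
  of Anderson acceleration with memory \<open>m\<close> applied to \<open>H\<close> from \<open>x 0\<close>. The coefficients need not be
  unique.\<close>

definition anderson ::
  "nat \<Rightarrow> ('a::real_normed_vector \<Rightarrow> 'a) \<Rightarrow> (nat \<Rightarrow> 'a) \<Rightarrow> (nat \<Rightarrow> nat \<Rightarrow> real) \<Rightarrow> bool" where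
  "anderson m H x \<alpha> \<longleftrightarrow>
     (\<forall>k. let q = min m k; r = (\<lambda>j. H (x j) - x j) in
        (\<Sum>i\<le>q. \<alpha> k i) = 1 \<and>
        (\<forall>\<beta> :: nat \<Rightarrow> real. (\<Sum>i\<le>q. \<beta> i) = 1 \<longrightarrow>
           (norm (\<Sum>i\<le>q. \<alpha> k i *\<^sub>R r (k - q + i)))\<^sup>2 \<le>
           (norm (\<Sum>i\<le>q. \<beta> i *\<^sub>R r (k - q + i)))\<^sup>2) \<and>
        x (Suc k) = (\<Sum>i\<le>q. \<alpha> k i *\<^sub>R H (x (k - q + i))))"

end

theory Submission
  imports Defs
begin

text \<open>For (i), the manifold is straightened by a \<open>C\<^sup>3\<close> diffeomorphism \<open>\<Psi>\<close> of the ambient space with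
  inverse \<open>\<theta>\<close>, which turns \<open>H x\<close> into a local minimizer of \<open>u \<mapsto> \<sigma> (x, \<theta> u)\<close> over a linear subspace, where
  \<open>\<sigma>\<close> is the smooth extension of \<open>s\<close>. Strong minimality at \<open>x\<^sup>*\<close> makes the first-order condition
  nondegenerate. Since \<open>H\<close> is continuous by hypothesis, no existence part of the implicit function
  theorem is needed: a continuous solution of a nondegenerate smooth equation is smooth.
  For (ii), the residuals satisfy \<open>\<parallel>r\<^sup>k\<^sup>+\<^sup>1\<parallel> \<le> \<gamma> \<parallel>r\<^sup>k\<parallel>\<close> up to a term quadratic in the recent errors, which
  is absorbed by any rate \<open>g > \<gamma>\<close> if the initial error is small.\<close>

section \<open>Calculus of finite order smoothness\<close>

text \<open>\<open>Ck_on\<close> speaks of derivatives along fixed vectors only. Everything about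
  operators (inverses, Jacobians, norm bounds) is therefore reached through the columns
  \<open>A x e\<close> with \<open>e\<close> in \<open>Basis\<close>. The dimension of the manifold
  is a number and not a type, so there is no coordinate space of that dimension to parametrize over.
  This is why the straightening takes place in the ambient space, and why the first-order condition
  along the subspace is padded by the component orthogonal to it: the system becomes square. Passing
  to the first-order condition costs one derivative, hence C^3 data give a C^2 map. What (ii) takes
  from (i) is a quadratic Taylor remainder at the fixed point. In (ii) the coefficients may be
  negative, so mixing can enlarge errors, and the quadratic term is governed by the oldest stored
  error. Its square decays like g^(2(n-q)) with q = min m n, while g^n is wanted; the deficit is at
  most a factor g^m, which the smallness of the initial error has to pay for. The factor
  (1+\<gamma>)/(1-\<gamma>) is the quotient of the two constants that compare residual and
  error.\<close>

text \<open>On an open set a derivative depends only on the values in the set, so the equality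
  passes to all directional derivatives and the induction runs over pairs of functions.\<close>

lemma Ck_on_cong:
  assumes "open S" "\<And>x. x \<in> S \<Longrightarrow> f x = g x" "Ck_on k S f"
  shows "Ck_on k S g"
  using assms(2,3)
proof (induction k arbitrary: f g)
  case 0
  then show ?case by (simp cong: continuous_on_cong)
next
  case (Suc k)
  have diff: "f differentiable (at x)" if "x \<in> S" for x
    using Suc.prems(2) that by simp
  have "g differentiable (at x)" if "x \<in> S" for x
    using diff[OF that] has_derivative_transform_within_open[of f _ x UNIV S g] \<open>open S\<close> that Suc.prems(1)
    unfolding differentiable_def by blast
  moreover have "Ck_on k S (\<lambda>x. frechet_derivative g (at x) v)" for v
  proof (rule Suc.IH)
    show "Ck_on k S (\<lambda>x. frechet_derivative f (at x) v)" using Suc.prems(2) by simp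
    show "frechet_derivative f (at x) v = frechet_derivative g (at x) v" if "x \<in> S" for x
      by (simp add: frechet_derivative_transform_within_open[OF diff[OF that] \<open>open S\<close> that Suc.prems(1)])
  qed
  ultimately show ?case by simp
qed

text \<open>By uniqueness of the derivative, any formula \<open>f'\<close> valid on \<open>S\<close>
  may replace \<open>frechet_derivative\<close>. The calculus rules below use this to supply their
  own derivative formulas.\<close>

lemma Ck_on_SucI:
  assumes "open S" "\<And>x. x \<in> S \<Longrightarrow> (f has_derivative f' x) (at x)"
    and "\<And>v. Ck_on k S (\<lambda>x. f' x v)"
  shows "Ck_on (Suc k) S f"
proof -
  have "Ck_on k S (\<lambda>x. frechet_derivative f (at x) v)" for v
    by (rule Ck_on_cong[OF assms(1) _ assms(3)[of v]])
      (simp add: frechet_derivative_at[OF assms(2), symmetric])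
  then show ?thesis
    using assms(2) unfolding Ck_on.simps differentiable_def by blast
qed

lemma Ck_on_SucD:
  assumes "Ck_on (Suc k) S f"
  shows "x \<in> S \<Longrightarrow> (f has_derivative frechet_derivative f (at x)) (at x)"
    and "Ck_on k S (\<lambda>x. frechet_derivative f (at x) v)"
  using assms by (auto simp: frechet_derivative_works[symmetric])

lemma Ck_on_imp_continuous_on: "Ck_on k S f \<Longrightarrow> continuous_on S f"
  by (cases k)
    (simp_all add: differentiable_imp_continuous_within continuous_at_imp_continuous_on)

lemma Ck_on_Suc_imp: "Ck_on (Suc k) S f \<Longrightarrow> Ck_on k S f"
proof (induction k arbitrary: f)
  case 0
  show ?case using Ck_on_imp_continuous_on[OF 0] by simp
next
  case (Suc k)
  have "Ck_on k S (\<lambda>x. frechet_derivative f (at x) v)" for v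
    by (rule Suc.IH[OF Ck_on_SucD(2)[OF Suc.prems]])
  then show ?case using Suc.prems by (simp only: Ck_on.simps(2)) blast
qed

lemma Ck_on_mono:
  assumes "Ck_on k S f" "j \<le> k"
  shows "Ck_on j S f"
  using assms(2,1)
proof (induction rule: dec_induct)
  case (step i)
  then show ?case by (simp only: Ck_on_Suc_imp)
qed

lemma Ck_on_subset: "Ck_on k S f \<Longrightarrow> T \<subseteq> S \<Longrightarrow> Ck_on k T f"
  by (induction k arbitrary: f) (auto intro: continuous_on_subset)

lemma Ck_on_const: "open S \<Longrightarrow> Ck_on k S (\<lambda>x. c)"
  by (induction k arbitrary: c) (auto)

lemma Ck_on_bounded_linear_compose:
  assumes "bounded_linear L" "open S" "Ck_on k S f"
  shows "Ck_on k S (\<lambda>x. L (f x))"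
  using assms(3)
proof (induction k arbitrary: f)
  case 0
  then show ?case using bounded_linear.continuous_on[OF assms(1)] by simp
next
  case (Suc k)
  show ?case
    by (rule Ck_on_SucI[OF assms(2), where f' = "\<lambda>x v. L (frechet_derivative f (at x) v)"])
      (intro bounded_linear.has_derivative[OF assms(1)] Suc.IH Ck_on_SucD[OF Suc.prems] | assumption)+
qed

lemma Ck_on_bounded_linear:
  assumes "bounded_linear L" "open S"
  shows "Ck_on k S L"
proof (cases k)
  case 0
  then show ?thesis using linear_continuous_on[OF assms(1)] by simp
next
  case (Suc j)
  show ?thesis
    unfolding Suc
    by (rule Ck_on_SucI[OF assms(2)])
      (auto intro: Ck_on_const assms bounded_linear_imp_has_derivative)
qed

lemma Ck_on_add:
  assumes "open S" "Ck_on k S f" "Ck_on k S g"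
  shows "Ck_on k S (\<lambda>x. f x + g x)"
  using assms(2,3)
proof (induction k arbitrary: f g)
  case 0
  then show ?case by (simp add: continuous_on_add)
next
  case (Suc k)
  show ?case
    by (rule Ck_on_SucI[OF assms(1),
          where f' = "\<lambda>x v. frechet_derivative f (at x) v + frechet_derivative g (at x) v"])
      (intro has_derivative_add Suc.IH Ck_on_SucD[OF Suc.prems(1)] Ck_on_SucD[OF Suc.prems(2)]
        | assumption)+
qed

lemma Ck_on_diff:
  assumes "open S" "Ck_on k S f" "Ck_on k S g"
  shows "Ck_on k S (\<lambda>x. f x - g x)"
  using Ck_on_add[OF assms(1,2) Ck_on_bounded_linear_compose[OF
        bounded_linear_minus[OF bounded_linear_ident] assms(1,3)]]
  by simp

lemma Ck_on_sum:
  assumes "open S" "\<And>i. i \<in> I \<Longrightarrow> Ck_on k S (f i)"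
  shows "Ck_on k S (\<lambda>x. \<Sum>i\<in>I. f i x)"
  using assms(2)
proof (induction I rule: infinite_finite_induct)
  case (insert i I)
  then show ?case by (simp add: Ck_on_add[OF assms(1)])
qed (simp_all add: Ck_on_const[OF assms(1)])

text \<open>The product rule leaves one factor undifferentiated in each summand. The induction
  hypothesis therefore needs that factor at the lower order, which \<open>Ck_on_Suc_imp\<close>
  provides.\<close>

lemma Ck_on_bilinear:
  assumes "bounded_bilinear B" "open S" "Ck_on k S f" "Ck_on k S g"
  shows "Ck_on k S (\<lambda>x. B (f x) (g x))"
  using assms(3,4)
proof (induction k arbitrary: f g)
  case 0
  then show ?case using bounded_bilinear.continuous_on[OF assms(1)] by simp
next
  case (Suc k)
  note f = Ck_on_SucD[OF Suc.prems(1)] and g = Ck_on_SucD[OF Suc.prems(2)]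
  show ?case
  proof (rule Ck_on_SucI[OF assms(2)])
    show "((\<lambda>x. B (f x) (g x)) has_derivative
        (\<lambda>v. B (f x) (frechet_derivative g (at x) v) + B (frechet_derivative f (at x) v) (g x))) (at x)"
      if "x \<in> S" for x
      by (rule bounded_bilinear.FDERIV[OF assms(1) f(1)[OF that] g(1)[OF that]])
    show "Ck_on k S (\<lambda>x. B (f x) (frechet_derivative g (at x) v)
        + B (frechet_derivative f (at x) v) (g x))" for v
      by (intro Ck_on_add Suc.IH f g assms(2) Ck_on_Suc_imp[OF Suc.prems(1)]
          Ck_on_Suc_imp[OF Suc.prems(2)])
  qed
qed

lemmas Ck_on_scaleR = Ck_on_bilinear[OF bounded_bilinear_scaleR]
lemmas Ck_on_inner = Ck_on_bilinear[OF bounded_bilinear_inner]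

lemma Ck_on_Pair:
  assumes "open S" "Ck_on k S f" "Ck_on k S g"
  shows "Ck_on k S (\<lambda>x. (f x, g x))"
proof -
  have l: "bounded_linear (\<lambda>y. (y, 0))" and r: "bounded_linear (\<lambda>y. (0, y))"
    by (intro bounded_linear_Pair bounded_linear_ident bounded_linear_zero)+
  have "Ck_on k S (\<lambda>x. (f x, 0) + (0, g x))"
    by (intro Ck_on_add assms(1) Ck_on_bounded_linear_compose[OF l assms(1,2)]
        Ck_on_bounded_linear_compose[OF r assms(1,3)])
  then show ?thesis by simp
qed

section \<open>Derivatives along moving directions, the chain rule, and first- and second-order
  bounds\<close>

lemma linear_expand:
  fixes L :: "'a::euclidean_space \<Rightarrow> 'b::real_normed_vector"
  assumes "linear L"
  shows "L w = (\<Sum>e\<in>Basis. (w \<bullet> e) *\<^sub>R L e)"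
proof -
  have "L (\<Sum>e\<in>Basis. (w \<bullet> e) *\<^sub>R e) = (\<Sum>e\<in>Basis. (w \<bullet> e) *\<^sub>R L e)"
    by (simp only: linear_sum[OF assms] linear_scale[OF assms])
  then show ?thesis by (simp add: euclidean_representation)
qed

text \<open>In the chain rule both the base point \<open>p x\<close> and the direction
  \<open>v x\<close> move, whereas \<open>Ck_on\<close> controls fixed directions only. Expanding
  \<open>v x\<close> in the basis separates the two dependences.\<close>

lemma Ck_on_frechet_derivative:
  fixes f :: "'a::euclidean_space \<Rightarrow> 'b::real_normed_vector"
  assumes "open S" "\<And>x. x \<in> S \<Longrightarrow> f differentiable (at (p x))"
    and "\<And>e. Ck_on k S (\<lambda>x. frechet_derivative f (at (p x)) e)" "Ck_on k S v"
  shows "Ck_on k S (\<lambda>x. frechet_derivative f (at (p x)) (v x))"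
proof (rule Ck_on_cong[OF assms(1)])
  show "Ck_on k S (\<lambda>x. \<Sum>e\<in>Basis. (v x \<bullet> e) *\<^sub>R frechet_derivative f (at (p x)) e)"
    by (rule Ck_on_sum[OF assms(1) Ck_on_scaleR[OF assms(1) Ck_on_inner[OF assms(1,4)
              Ck_on_const[OF assms(1)]] assms(3)]])
  show "(\<Sum>e\<in>Basis. (v x \<bullet> e) *\<^sub>R frechet_derivative f (at (p x)) e)
      = frechet_derivative f (at (p x)) (v x)" if "x \<in> S" for x
    by (rule linear_expand[OF linear_frechet_derivative[OF assms(2)[OF that]], symmetric])
qed

lemma Ck_on_compose:
  fixes f :: "'b::euclidean_space \<Rightarrow> 'c::real_normed_vector"
  assumes "open S" "Ck_on k T f" "Ck_on k S g" "g ` S \<subseteq> T"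
  shows "Ck_on k S (\<lambda>x. f (g x))"
  using assms(2,3)
proof (induction k arbitrary: f)
  case 0
  then show ?case using continuous_on_compose2 assms(4) by auto
next
  case (Suc k)
  note f = Ck_on_SucD[OF Suc.prems(1)] and g = Ck_on_SucD[OF Suc.prems(2)]
  show ?case
  proof (rule Ck_on_SucI[OF assms(1)])
    show "((\<lambda>x. f (g x)) has_derivative
        (\<lambda>v. frechet_derivative f (at (g x)) (frechet_derivative g (at x) v))) (at x)"
      if "x \<in> S" for x
      using that assms(4) by (intro has_derivative_compose[OF g(1)] f(1)) auto
    show "Ck_on k S (\<lambda>x. frechet_derivative f (at (g x)) (frechet_derivative g (at x) v))" for v
    proof (rule Ck_on_frechet_derivative[OF assms(1)])
      show "f differentiable at (g x)" if "x \<in> S" for x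
        using f(1)[of "g x"] that assms(4) differentiable_def by blast
    qed (intro Suc.IH f(2) g(2) Ck_on_Suc_imp[OF Suc.prems(2)])+
  qed
qed

text \<open>The sum of the column norms is cruder than \<open>onorm\<close>, but it is visibly
  continuous in a parameter as soon as every column is, and this is the information that
  \<open>Ck_on\<close> gives.\<close>

lemma linear_norm_le_sum_Basis:
  fixes L :: "'a::euclidean_space \<Rightarrow> 'b::real_normed_vector"
  assumes "linear L"
  shows "norm (L w) \<le> (\<Sum>e\<in>Basis. norm (L e)) * norm w"
proof -
  have "norm (L w) \<le> (\<Sum>e\<in>Basis. norm ((w \<bullet> e) *\<^sub>R L e))"
    by (subst linear_expand[OF assms]) (rule norm_sum)
  also have "\<dots> \<le> (\<Sum>e\<in>Basis. norm (L e) * norm w)"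
  proof (rule sum_mono)
    fix e :: 'a assume "e \<in> Basis"
    then have "\<bar>w \<bullet> e\<bar> \<le> norm w" by (rule Basis_le_norm)
    then show "norm ((w \<bullet> e) *\<^sub>R L e) \<le> norm (L e) * norm w"
      by (simp add: mult.commute[of "norm (L e)"] mult_right_mono)
  qed
  finally show ?thesis by (simp add: sum_distrib_right)
qed

lemma Ck_on_locally_lipschitz:
  fixes f :: "'a::euclidean_space \<Rightarrow> 'b::real_normed_vector"
  assumes "open S" "x0 \<in> S" "Ck_on (Suc k) S f"
  obtains \<epsilon> L where "\<epsilon> > 0" "ball x0 \<epsilon> \<subseteq> S" "L-lipschitz_on (ball x0 \<epsilon>) f"
proof -
  note f = Ck_on_SucD[OF assms(3)]
  obtain \<epsilon> where \<epsilon>: "\<epsilon> > 0" "cball x0 \<epsilon> \<subseteq> S"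
    using assms(1,2) open_contains_cball by blast
  define g where "g x = (\<Sum>e\<in>Basis. norm (frechet_derivative f (at x) e))" for x
  have "continuous_on (cball x0 \<epsilon>) g"
    unfolding g_def
    by (intro continuous_intros continuous_on_subset[OF Ck_on_imp_continuous_on[OF f(2)] \<epsilon>(2)])
  then have "bounded (g ` cball x0 \<epsilon>)"
    by (intro compact_imp_bounded compact_continuous_image compact_cball)
  then obtain L where L: "L > 0" "\<And>x. x \<in> cball x0 \<epsilon> \<Longrightarrow> norm (g x) \<le> L"
    unfolding bounded_pos by blast
  have "norm (f x - f y) \<le> L * norm (x - y)" if "x \<in> ball x0 \<epsilon>" "y \<in> ball x0 \<epsilon>" for x y
  proof (rule differentiable_bound[OF convex_ball _ _ that])
    fix z assume "z \<in> ball x0 \<epsilon>"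
    then have z: "z \<in> cball x0 \<epsilon>" "z \<in> S" using \<epsilon>(2) by auto
    show d: "(f has_derivative frechet_derivative f (at z)) (at z within ball x0 \<epsilon>)"
      using f(1)[OF z(2)] by (rule has_derivative_at_withinI)
    have "norm (frechet_derivative f (at z) v) \<le> L * norm v" for v
    proof -
      have "norm (frechet_derivative f (at z) v) \<le> g z * norm v"
        unfolding g_def by (rule linear_norm_le_sum_Basis[OF has_derivative_linear[OF d]])
      also have "\<dots> \<le> L * norm v" using L(2)[OF z(1)] by (intro mult_right_mono) auto
      finally show ?thesis .
    qed
    then show "onorm (frechet_derivative f (at z)) \<le> L" by (rule onorm_le)
  qed
  then have "L-lipschitz_on (ball x0 \<epsilon>) f"
    using L(1) by (intro lipschitz_onI) (auto simp: dist_norm)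
  moreover have "ball x0 \<epsilon> \<subseteq> S" using \<epsilon>(2) ball_subset_cball by blast
  ultimately show ?thesis using that \<epsilon>(1) by blast
qed

text \<open>The Jacobian is a finite sum of entries times the constant matrix units
  \<open>axis i (axis j 1)\<close>, and each entry is a component of a directional
  derivative.\<close>

lemma Ck_on_jacobian:
  fixes f :: "real ^ 'n \<Rightarrow> real ^ 'm"
  assumes "open S" "Ck_on (Suc k) S f"
  shows "Ck_on k S (\<lambda>x. jacobian f (at x))"
proof (rule Ck_on_cong[OF \<open>open S\<close>])
  show "Ck_on k S (\<lambda>x. \<Sum>i\<in>UNIV. \<Sum>j\<in>UNIV.
      (frechet_derivative f (at x) (axis j 1) $ i) *\<^sub>R (axis i (axis j 1) :: real ^ 'n ^ 'm))"
    by (intro Ck_on_sum[OF \<open>open S\<close>] Ck_on_scaleR[OF \<open>open S\<close>]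
        Ck_on_bounded_linear_compose[OF bounded_linear_vec_nth \<open>open S\<close>] Ck_on_const[OF \<open>open S\<close>] Ck_on_SucD(2)[OF assms(2)])
  show "(\<Sum>i\<in>UNIV. \<Sum>j\<in>UNIV. (frechet_derivative f (at x) (axis j 1) $ i) *\<^sub>R axis i (axis j 1))
      = jacobian f (at x)" if "x \<in> S" for x
    by (simp add: vec_eq_iff jacobian_def matrix_def axis_def if_distrib[where f = "\<lambda>v. v $ _"]
        if_distrib[where f = "(*) _"] sum.delta sum.If_cases cong: if_cong)
qed

text \<open>The remainder is the increment of \<phi>, that is \<open>f\<close> minus its derivative
  at \<open>x0\<close>. The derivative of \<phi> at \<open>y\<close> is the change of the derivative
  of \<open>f\<close> between \<open>x0\<close> and \<open>y\<close>. By Lipschitz continuity of its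
  columns this is at most \<open>K * \<rho>\<close> on the ball of radius \<rho> =
  \<open>norm (x - x0)\<close>, and the mean value inequality supplies the second factor
  \<rho>.\<close>

lemma Ck_on_2_quadratic_remainder:
  fixes f :: "'a::euclidean_space \<Rightarrow> 'b::real_normed_vector"
  assumes "open S" "x0 \<in> S" "Ck_on 2 S f"
  obtains \<epsilon> L where "\<epsilon> > 0" "\<And>x. x \<in> cball x0 \<epsilon> \<Longrightarrow>
    norm (f x - f x0 - frechet_derivative f (at x0) (x - x0)) \<le> L * (norm (x - x0))\<^sup>2"
proof -
  have f2: "Ck_on (Suc (Suc 0)) S f" using assms(3) by (simp only: numeral_2_eq_2)
  note f = Ck_on_SucD[OF f2]
  have "\<exists>\<epsilon> L. \<epsilon> > 0 \<and> ball x0 \<epsilon> \<subseteq> S \<and> L-lipschitz_on (ball x0 \<epsilon>) (\<lambda>x. frechet_derivative f (at x) e)" for e :: 'a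
    using Ck_on_locally_lipschitz[OF assms(1,2) f(2)[of e]] by metis
  then obtain E L where E: "\<And>e. E e > 0" "\<And>e. ball x0 (E e) \<subseteq> S"
    "\<And>e. (L e)-lipschitz_on (ball x0 (E e)) (\<lambda>x. frechet_derivative f (at x) e)"
    by metis
  \<comment> \<open>The Lipschitz radius depends on the basis vector; half of the least one puts the
    closed ball inside every open ball.\<close>
  define \<epsilon> where "\<epsilon> = Min (E ` Basis) / 2"
  have Min: "Min (E ` Basis) > 0" using E(1) by simp
  have \<epsilon>: "\<epsilon> > 0" "\<epsilon> < E e" if "e \<in> Basis" for e
  proof -
    have "Min (E ` Basis) \<le> E e" using that by simp
    then show "\<epsilon> > 0" "\<epsilon> < E e" using Min unfolding \<epsilon>_def by linarith+
  qed
  define K where "K = (\<Sum>e\<in>Basis. L e)"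
  have "norm (f x - f x0 - frechet_derivative f (at x0) (x - x0)) \<le> K * (norm (x - x0))\<^sup>2"
    if x: "x \<in> cball x0 \<epsilon>" for x
  proof -
    define \<rho> where "\<rho> = norm (x - x0)"
    define d where "d y v = frechet_derivative f (at y) v - frechet_derivative f (at x0) v" for y v
    have ball: "y \<in> ball x0 (E e)" if "y \<in> cball x0 \<rho>" "e \<in> Basis" for y e
      using that x \<epsilon>(2)[OF that(2)] by (simp add: \<rho>_def dist_norm norm_minus_commute)
    have S: "y \<in> S" if "y \<in> cball x0 \<rho>" for y
      using ball[OF that SOME_Basis] E(2) by blast
    have lin: "linear (d y)" if "y \<in> cball x0 \<rho>" for y
      unfolding d_def
      by (intro linear_compose_sub has_derivative_linear[OF f(1)] S that assms(2))
    define \<phi> where "\<phi> y = f y - frechet_derivative f (at x0) y" for y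
    have "norm (\<phi> x - \<phi> x0) \<le> (K * \<rho>) * norm (x - x0)"
    proof (rule differentiable_bound[OF convex_cball[of x0 \<rho>]])
      fix y assume y: "y \<in> cball x0 \<rho>"
      show "(\<phi> has_derivative d y) (at y within cball x0 \<rho>)"
        unfolding \<phi>_def d_def
        by (intro has_derivative_diff has_derivative_at_withinI[OF f(1)[OF S[OF y]]]
            bounded_linear_imp_has_derivative has_derivative_bounded_linear[OF f(1)[OF assms(2)]])
      have "(\<Sum>e\<in>Basis. norm (d y e)) \<le> (\<Sum>e\<in>Basis. L e * \<rho>)"
      proof (rule sum_mono)
        fix e :: 'a assume e: "e \<in> Basis"
        have "norm (d y e) \<le> L e * dist y x0"
          unfolding d_def dist_norm[symmetric]
          by (rule lipschitz_onD[OF E(3) ball[OF y e]]) (use E(1) in simp)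
        also have "\<dots> \<le> L e * \<rho>"
          using y lipschitz_on_nonneg[OF E(3)] by (intro mult_left_mono) (auto simp: dist_commute)
        finally show "norm (d y e) \<le> L e * \<rho>" .
      qed
      then have "norm (d y v) \<le> K * \<rho> * norm v" for v
        using linear_norm_le_sum_Basis[OF lin[OF y], of v]
          mult_right_mono[of _ "K * \<rho>" "norm v"]
        by (force simp: K_def sum_distrib_right intro: order_trans)
      then show "onorm (d y) \<le> K * \<rho>" by (rule onorm_le)
    qed (auto simp: \<rho>_def dist_norm norm_minus_commute)
    moreover have "\<phi> x - \<phi> x0 = f x - f x0 - frechet_derivative f (at x0) (x - x0)"
      by (simp add: \<phi>_def linear_diff[OF has_derivative_linear[OF f(1)[OF assms(2)]]])
    ultimately show ?thesis by (simp add: \<rho>_def power2_eq_square mult_ac)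
  qed
  then show ?thesis using that \<epsilon>(1)[OF SOME_Basis] by blast
qed

section \<open>Smoothness of continuous implicit functions\<close>

text \<open>Injectivity at \<open>x0\<close> is a lower bound with constant \<open>c\<close>. On
  \<open>T\<close> the columns have moved by less than \<open>c / 2\<close> in total, so half of the
  constant survives, uniformly in \<open>x\<close>.\<close>

lemma injective_linear_family_bounded_below:
  fixes A :: "'x::topological_space \<Rightarrow> 'a::euclidean_space \<Rightarrow> 'b::euclidean_space"
  assumes "open S" "x0 \<in> S" and lin: "\<And>x. x \<in> S \<Longrightarrow> linear (A x)"
    and cont: "\<And>e. continuous_on S (\<lambda>x. A x e)" and "inj (A x0)"
  obtains c T where "c > 0" "open T" "x0 \<in> T" "T \<subseteq> S"
    "\<And>x w. x \<in> T \<Longrightarrow> c * norm w \<le> norm (A x w)"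
proof -
  obtain c where c: "c > 0" "\<And>w. c * norm w \<le> norm (A x0 w)"
    using linear_inj_bounded_below_pos[OF lin[OF \<open>x0 \<in> S\<close>] \<open>inj (A x0)\<close>] by blast
  define g where "g x = (\<Sum>e\<in>Basis. norm (A x e - A x0 e))" for x
  have "continuous_on S g"
    unfolding g_def by (intro continuous_intros cont)
  define T where "T = {x \<in> S. g x < c / 2}"
  have "open T"
  proof -
    have "T = g -` {..<c/2} \<inter> S" unfolding T_def by auto
    then show ?thesis
      using continuous_on_open_vimage[OF \<open>open S\<close>] \<open>continuous_on S g\<close> by (metis open_lessThan)
  qed
  show ?thesis
  proof (rule that[of "c / 2" T])
    show "x0 \<in> T" using \<open>x0 \<in> S\<close> \<open>c > 0\<close> by (simp add: T_def g_def)
    show "c / 2 * norm w \<le> norm (A x w)" if "x \<in> T" for x w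
    proof -
      have "x \<in> S" "g x < c / 2" using that by (auto simp: T_def)
      have "norm (A x w - A x0 w) \<le> g x * norm w"
        unfolding g_def
        using linear_norm_le_sum_Basis[OF linear_compose_sub[OF lin[OF \<open>x \<in> S\<close>] lin[OF \<open>x0 \<in> S\<close>]]] .
      also have "\<dots> \<le> c / 2 * norm w"
        using \<open>g x < c / 2\<close> by (intro mult_right_mono) auto
      finally have "norm (A x0 w) - norm (A x w) \<le> c / 2 * norm w"
        using norm_triangle_ineq2[of "A x0 w" "A x w"] by (simp add: norm_minus_commute)
      then show ?thesis using c(2)[of w] by simp
    qed
  qed (use \<open>open T\<close> \<open>c > 0\<close> in \<open>auto simp: T_def\<close>)
qed

text \<open>The candidate h' is forced by D(v, h' v) = 0. For the defect d = \<Delta>h - h'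
  \<Delta>x this gives \<open>L d = D (\<Delta>x, \<Delta>h)\<close>, which differentiability of
  \<open>E\<close> along the graph makes small relative to the norms of \<Delta>x and \<Delta>h. As
  \<Delta>h is bounded by d and \<Delta>x, its d-part is absorbed into the lower bound for
  \<open>L d\<close>. Only continuity of \<open>h\<close> is used to stay near the base
  point.\<close>

lemma implicit_has_derivative:
  fixes E :: "'a::real_normed_vector \<times> 'b::euclidean_space \<Rightarrow> 'b"
  assumes E: "(E has_derivative D) (at (x0, h x0))"
    and inj: "inj (\<lambda>w. D (0, w))"
    and cont: "isCont h x0"
    and zero: "\<forall>\<^sub>F x in nhds x0. E (x, h x) = 0"
  obtains h' where "(h has_derivative h') (at x0)" "\<And>v. D (v, h' v) = 0"
proof -
  have bl: "bounded_linear D" using E by (rule has_derivative_bounded_linear)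
  have D_add: "D (a + b) = D a + D b" for a b
    using bl by (rule bounded_linear.linear[THEN linear_add])
  define L where "L w = D (0, w)" for w
  have bL: "bounded_linear L"
    unfolding L_def
    by (intro bounded_linear_compose[OF bl] bounded_linear_Pair bounded_linear_ident bounded_linear_zero)
  then have linL: "linear L" by (rule bounded_linear.linear)
  have injL: "inj L" using inj by (simp add: L_def[abs_def])
  obtain Li where Li: "linear Li" "\<And>w. L (Li w) = w"
    using linear_injective_isomorphism[OF linL injL] by blast
  define h' where "h' v = - Li (D (v, 0))" for v
  have "bounded_linear h'"
    unfolding h'_def
    by (intro bounded_linear_minus bounded_linear_compose[OF linear_conv_bounded_linear[THEN iffD1, OF Li(1)]]
        bounded_linear_compose[OF bl] bounded_linear_Pair bounded_linear_ident bounded_linear_zero)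
  then obtain K where K: "K > 0" "\<And>v. norm (h' v) \<le> K * norm v"
    using bounded_linear.pos_bounded[of h'] by (auto simp: mult.commute)
  have D0: "D (v, h' v) = 0" for v
  proof -
    have "D (v, h' v) = D (v, 0) + L (h' v)"
      unfolding L_def by (simp flip: D_add)
    also have "L (h' v) = - D (v, 0)"
      unfolding h'_def by (simp add: linear_neg[OF linL] Li(2))
    finally show ?thesis by simp
  qed
  obtain c where c: "c > 0" "\<And>w. c * norm w \<le> norm (L w)"
    using linear_inj_bounded_below_pos[OF linL injL] by blast
  have E0: "E (x0, h x0) = 0" using zero by (rule eventually_nhds_x_imp_x)
  have "(h has_derivative h') (at x0)"
    unfolding has_derivative_at_alt
  proof (intro conjI allI impI)
    fix e :: real assume "e > 0"
    \<comment> \<open>The bound \<open>c / 2\<close> lets half of \<open>c * norm d\<close> absorb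
      the defect on the right-hand side; the other entry reduces the remaining multiple of
      \<open>norm (x - x0)\<close> to \<open>e * c / 2\<close>.\<close>
    define \<eta> where "\<eta> = min (c / 2) (e * c / (2 * (1 + K)))"
    have \<eta>: "\<eta> > 0" "\<eta> \<le> c / 2" "\<eta> * (1 + K) \<le> e * c / 2"
    proof -
      show "\<eta> > 0" using \<open>e > 0\<close> \<open>c > 0\<close> \<open>K > 0\<close> by (simp add: \<eta>_def)
      show "\<eta> \<le> c / 2" unfolding \<eta>_def by (rule min.cobounded1)
      have "\<eta> \<le> e * c / (2 * (1 + K))" unfolding \<eta>_def by (rule min.cobounded2)
      then show "\<eta> * (1 + K) \<le> e * c / 2" using \<open>K > 0\<close> by (simp add: field_simps)
    qed
    obtain \<delta> where \<delta>: "\<delta> > 0" "\<And>y. norm (y - (x0, h x0)) < \<delta> \<Longrightarrow>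
        norm (E y - E (x0, h x0) - D (y - (x0, h x0))) \<le> \<eta> * norm (y - (x0, h x0))"
      using E \<open>\<eta> > 0\<close> unfolding has_derivative_at_alt by meson
    have "isCont (\<lambda>x. (x, h x)) x0" using cont by (intro continuous_intros)
    then have "\<forall>\<^sub>F x in nhds x0. dist (x, h x) (x0, h x0) < \<delta>"
      unfolding isCont_def tendsto_at_iff_tendsto_nhds[of "\<lambda>x. (x, h x)"]
      by (rule tendstoD) (rule \<open>\<delta> > 0\<close>)
    with zero have "\<forall>\<^sub>F x in nhds x0. norm (h x - h x0 - h' (x - x0)) \<le> e * norm (x - x0)"
    proof eventually_elim
      case (elim x)
      define d where "d = h x - h x0 - h' (x - x0)"
      have "D ((x, h x) - (x0, h x0)) = D (x - x0, h' (x - x0)) + L d"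
        unfolding L_def d_def by (simp flip: D_add)
      then have "L d = D ((x, h x) - (x0, h x0))" by (simp add: D0)
      then have "c * norm d \<le> norm (D ((x, h x) - (x0, h x0)))" using c(2)[of d] by simp
      also have "\<dots> \<le> \<eta> * norm ((x, h x) - (x0, h x0))"
        using \<delta>(2)[of "(x, h x)"] elim by (simp add: E0 dist_norm)
      also have "norm ((x, h x) - (x0, h x0)) \<le> norm (x - x0) + norm (h x - h x0)"
        using norm_Pair_le by auto
      also have "norm (h x - h x0) \<le> norm d + K * norm (x - x0)"
        using norm_triangle_ineq[of d "h' (x - x0)"] K(2)[of "x - x0"] by (simp add: d_def)
      finally have "c * norm d \<le> \<eta> * (norm (x - x0) + (norm d + K * norm (x - x0)))"
        using \<open>\<eta> > 0\<close> by simp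
      also have "\<dots> = \<eta> * (1 + K) * norm (x - x0) + \<eta> * norm d" by (simp add: algebra_simps)
      also have "\<dots> \<le> e * c / 2 * norm (x - x0) + c / 2 * norm d"
        by (intro add_mono mult_right_mono \<eta> norm_ge_zero)
      finally have "c * norm d \<le> c * (e * norm (x - x0))" by (simp add: algebra_simps)
      then show ?case using \<open>c > 0\<close> by (simp add: d_def)
    qed
    then show "\<exists>d>0. \<forall>y. norm (y - x0) < d \<longrightarrow> norm (h y - h x0 - h' (y - x0)) \<le> e * norm (y - x0)"
      by (simp add: eventually_nhds_metric dist_norm)
  qed fact
  then show ?thesis using D0 that by blast
qed

text \<open>Applying \<open>A x\<close> to \<open>w x - w x0\<close> gives
  \<open>b x - A x (w x0)\<close>. This involves the unknown only at the fixed point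
  \<open>x0\<close> and tends to 0, and the uniform lower bound for \<open>A x\<close> transfers the
  limit to \<open>w\<close>.\<close>

lemma continuous_on_linear_solve:
  fixes A :: "'x::t2_space \<Rightarrow> 'a::euclidean_space \<Rightarrow> 'a"
  assumes "open S" and lin: "\<And>x. x \<in> S \<Longrightarrow> linear (A x)"
    and inj: "\<And>x. x \<in> S \<Longrightarrow> inj (A x)"
    and A: "\<And>e. continuous_on S (\<lambda>x. A x e)" and b: "continuous_on S b"
    and w: "\<And>x. x \<in> S \<Longrightarrow> A x (w x) = b x"
  shows "continuous_on S w"
  unfolding continuous_on_eq_continuous_at[OF \<open>open S\<close>]
proof
  fix x0 assume "x0 \<in> S"
  obtain c T where c: "c > 0" "open T" "x0 \<in> T" "T \<subseteq> S"
    "\<And>x w. x \<in> T \<Longrightarrow> c * norm w \<le> norm (A x w)"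
    using injective_linear_family_bounded_below[OF \<open>open S\<close> \<open>x0 \<in> S\<close> lin A inj[OF \<open>x0 \<in> S\<close>]] by metis
  define q where "q x = norm (b x - A x (w x0)) / c" for x
  have "continuous_on S q"
    unfolding q_def using \<open>c > 0\<close> by (intro continuous_intros A b) auto
  then have "isCont q x0" using \<open>x0 \<in> S\<close> continuous_on_eq_continuous_at[OF \<open>open S\<close>] by blast
  moreover have "q x0 = 0" using w[OF \<open>x0 \<in> S\<close>] by (simp add: q_def)
  ultimately have q: "(q \<longlongrightarrow> 0) (at x0)" by (simp add: isCont_def)
  have "\<forall>\<^sub>F x in at x0. norm (w x - w x0) \<le> q x"
    using eventually_at_in_open'[OF c(2,3)]
  proof eventually_elim
    case (elim x)
    then have "x \<in> S" using c(4) by auto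
    have "c * norm (w x - w x0) \<le> norm (A x (w x - w x0))" using c(5)[OF elim] .
    also have "A x (w x - w x0) = b x - A x (w x0)"
      by (simp add: linear_diff[OF lin[OF \<open>x \<in> S\<close>]] w[OF \<open>x \<in> S\<close>])
    finally show ?case using \<open>c > 0\<close> by (simp add: q_def field_simps)
  qed
  then have "((\<lambda>x. w x - w x0) \<longlongrightarrow> 0) (at x0)" using q by (rule Lim_null_comparison)
  then show "isCont w x0" by (simp add: isCont_def LIM_zero_iff)
qed

text \<open>The derivative of the solution of \<open>A x (w x) = b x\<close> solves a system with the same
  matrix, so smoothness follows by induction, without a formula for the inverse matrix.\<close>

lemma Ck_on_linear_solve:
  fixes A :: "'x::real_normed_vector \<Rightarrow> 'a::euclidean_space \<Rightarrow> 'a"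
  assumes "open S" and lin: "\<And>x. x \<in> S \<Longrightarrow> linear (A x)"
    and inj: "\<And>x. x \<in> S \<Longrightarrow> inj (A x)"
    and "\<And>e. Ck_on k S (\<lambda>x. A x e)" "Ck_on k S b" "\<And>x. x \<in> S \<Longrightarrow> A x (w x) = b x"
  shows "Ck_on k S w"
  using assms(4-6)
proof (induction k arbitrary: b w)
  case 0
  then show ?case using continuous_on_linear_solve[OF \<open>open S\<close> lin inj, where b = b and w = w] by simp
next
  case (Suc k)
  note A = Ck_on_SucD[OF Suc.prems(1)] and b = Ck_on_SucD[OF Suc.prems(2)]
  \<comment> \<open>The system solved by the derivative contains \<open>w\<close> itself on its
    right-hand side, so the lower order must be available beforehand.\<close>
  have wk: "Ck_on k S w"
    by (rule Suc.IH[OF Ck_on_Suc_imp[OF Suc.prems(1)] Ck_on_Suc_imp[OF Suc.prems(2)] Suc.prems(3)])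
  \<comment> \<open>The equation is written through the columns \<open>A x e\<close>:
    differentiability in \<open>x\<close> is known only for them.\<close>
  define E where "E = (\<lambda>(x, u). (\<Sum>e\<in>Basis. (u \<bullet> e) *\<^sub>R A x e) - b x)"
  define rhs where "rhs v x = frechet_derivative b (at x) v
      - (\<Sum>e\<in>Basis. (w x \<bullet> e) *\<^sub>R frechet_derivative (\<lambda>x. A x e) (at x) v)" for v x
  have "\<exists>w'. (w has_derivative w') (at x) \<and> (\<forall>v. A x (w' v) = rhs v x)" if "x \<in> S" for x
  proof -
    define D where "D = (\<lambda>p. (\<Sum>e\<in>Basis. (w x \<bullet> e) *\<^sub>R frechet_derivative (\<lambda>x. A x e) (at x) (fst p)
        + (snd p \<bullet> e) *\<^sub>R A x e) - frechet_derivative b (at x) (fst p))"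
    note fst' = bounded_linear_imp_has_derivative[OF bounded_linear_fst]
    have fA: "((\<lambda>p. A (fst p) e) has_derivative
        (\<lambda>p. frechet_derivative (\<lambda>x. A x e) (at x) (fst p))) (at (x, w x))" for e
      by (rule has_derivative_compose[OF fst', where g = "\<lambda>x. A x e"]) (simp add: A(1)[OF that])
    have fb: "((\<lambda>p. b (fst p)) has_derivative
        (\<lambda>p. frechet_derivative b (at x) (fst p))) (at (x, w x))"
      by (rule has_derivative_compose[OF fst', where g = b]) (simp add: b(1)[OF that])
    have fu: "((\<lambda>p. snd p \<bullet> e) has_derivative (\<lambda>p. snd p \<bullet> e)) (at (x, w x))" for e
      by (auto intro!: derivative_eq_intros)
    have ED: "(E has_derivative D) (at (x, w x))"
      unfolding E_def D_def case_prod_unfold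
      using has_derivative_diff[OF has_derivative_sum[OF has_derivative_scaleR[OF fu fA]] fb]
      by simp
    have D0: "D (0, u) = A x u" for u
      using linear_expand[OF lin[OF that], of u] linear_0[OF has_derivative_linear[OF A(1)[OF that]]]
        linear_0[OF has_derivative_linear[OF b(1)[OF that]]]
      by (simp add: D_def)
    have "\<forall>\<^sub>F y in nhds x. E (y, w y) = 0"
      using eventually_nhds_in_open[OF \<open>open S\<close> that]
    proof eventually_elim
      case (elim y)
      then show ?case
        using linear_expand[OF lin[OF elim], of "w y"] Suc.prems(3)[OF elim] by (simp add: E_def)
    qed
    moreover have "isCont w x"
      using Ck_on_imp_continuous_on[OF wk] that continuous_on_eq_continuous_at[OF \<open>open S\<close>] by blast
    ultimately obtain w' where w': "(w has_derivative w') (at x)" "\<And>v. D (v, w' v) = 0"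
      using implicit_has_derivative[where h = w, OF ED] inj[OF \<open>x \<in> S\<close>] D0 by auto
    have "A x (w' v) = rhs v x" for v
    proof -
      have "D (v, w' v) = A x (w' v) - rhs v x"
        using linear_expand[OF lin[OF that], of "w' v"]
        by (simp add: D_def rhs_def sum.distrib algebra_simps)
      then show ?thesis using w'(2)[of v] by simp
    qed
    then show ?thesis using w'(1) by blast
  qed
  then obtain w' where w': "\<And>x. x \<in> S \<Longrightarrow> (w has_derivative w' x) (at x)"
    "\<And>x v. x \<in> S \<Longrightarrow> A x (w' x v) = rhs v x" by metis
  show ?case
  proof (rule Ck_on_SucI[OF \<open>open S\<close> w'(1)])
    show "Ck_on k S (\<lambda>x. w' x v)" for v
    proof (rule Suc.IH[OF Ck_on_Suc_imp[OF Suc.prems(1)] _ w'(2)])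
      show "Ck_on k S (rhs v)"
        unfolding rhs_def
        by (rule Ck_on_diff[OF \<open>open S\<close> b(2) Ck_on_sum[OF \<open>open S\<close> Ck_on_scaleR[OF \<open>open S\<close>
                Ck_on_inner[OF \<open>open S\<close> wk Ck_on_const[OF \<open>open S\<close>]] A(2)]]])
    qed
  qed
qed

text \<open>Bootstrapping: the derivative of \<open>h\<close> solves a linear system whose
  coefficients are derivatives of \<open>E\<close> along the graph of \<open>h\<close>. If
  \<open>h\<close> is C^j with j \<le> k, these coefficients are C^j, hence so is the derivative of
  \<open>h\<close>, and \<open>h\<close> is C^(j+1). The order of \<open>E\<close> stops the
  induction at \<open>Suc k\<close>. The set \<open>T\<close> is where invertibility at
  \<open>x0\<close> persists.\<close>

lemma Ck_on_implicit:
  fixes E :: "'a::euclidean_space \<times> 'b::euclidean_space \<Rightarrow> 'b"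
  assumes E: "Ck_on (Suc k) W E"
    and S: "open S" "x0 \<in> S" "continuous_on S h"
    and W: "\<And>x. x \<in> S \<Longrightarrow> (x, h x) \<in> W" and zero: "\<And>x. x \<in> S \<Longrightarrow> E (x, h x) = 0"
    and inj: "inj (\<lambda>w. frechet_derivative E (at (x0, h x0)) (0, w))"
  obtains T where "open T" "x0 \<in> T" "T \<subseteq> S" "Ck_on (Suc k) T h"
proof -
  note E' = Ck_on_SucD[OF E]
  define A where "A x w = frechet_derivative E (at (x, h x)) (0, w)" for x w
  have bl0: "bounded_linear (\<lambda>w. (0::'a, w::'b))"
    by (intro bounded_linear_Pair bounded_linear_ident bounded_linear_zero)
  have lin: "linear (A x)" if "x \<in> S" for x
    unfolding A_def
    using bounded_linear_compose[OF has_derivative_bounded_linear[OF E'(1)[OF W[OF that]]] bl0]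
    by (rule bounded_linear.linear)
  have "continuous_on S (\<lambda>x. frechet_derivative E (at (x, h x)) v)" for v
    by (rule continuous_on_compose2[OF Ck_on_imp_continuous_on[OF E'(2)[of v]]])
      (use W S in \<open>auto intro!: continuous_intros\<close>)
  then have cont: "continuous_on S (\<lambda>x. A x e)" for e
    by (simp add: A_def)
  obtain c T where T: "c > 0" "open T" "x0 \<in> T" "T \<subseteq> S"
    "\<And>x w. x \<in> T \<Longrightarrow> c * norm w \<le> norm (A x w)"
    using injective_linear_family_bounded_below[OF S(1,2) lin cont] inj unfolding A_def by blast
  have injT: "inj (A x)" if "x \<in> T" for x
  proof -
    have "w = 0" if "A x w = 0" for w
      using T(5)[OF \<open>x \<in> T\<close>, of w] \<open>c > 0\<close> that by (simp add: mult_le_0_iff)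
    then show ?thesis
      using lin[of x] \<open>x \<in> T\<close> T(4) by (auto simp: linear_injective_0)
  qed
  have "\<exists>h'. (h has_derivative h') (at x) \<and> (\<forall>v. A x (h' v) = - frechet_derivative E (at (x, h x)) (v, 0))"
    if "x \<in> T" for x
  proof -
    have "x \<in> S" using that T(4) by auto
    have "\<forall>\<^sub>F y in nhds x. E (y, h y) = 0"
      using eventually_nhds_in_open[OF \<open>open S\<close> \<open>x \<in> S\<close>] by eventually_elim (rule zero)
    moreover have "isCont h x"
      using S(3) \<open>x \<in> S\<close> continuous_on_eq_continuous_at[OF \<open>open S\<close>] by blast
    ultimately obtain h' where h': "(h has_derivative h') (at x)"
      "\<And>v. frechet_derivative E (at (x, h x)) (v, h' v) = 0"
      using implicit_has_derivative[where h = h, OF E'(1)[OF W[OF \<open>x \<in> S\<close>]]] injT[OF \<open>x \<in> T\<close>]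
      unfolding A_def[abs_def] by blast
    have "A x (h' v) = - frechet_derivative E (at (x, h x)) (v, 0)" for v
    proof -
      have "frechet_derivative E (at (x, h x)) (v, h' v)
          = frechet_derivative E (at (x, h x)) (v, 0) + A x (h' v)"
        unfolding A_def
        using linear_add[OF has_derivative_linear[OF E'(1)[OF W[OF \<open>x \<in> S\<close>]]], of "(v, 0)" "(0, h' v)"]
        by simp
      then show ?thesis using h'(2)[of v] by (simp add: eq_neg_iff_add_eq_0 add.commute)
    qed
    then show ?thesis using h'(1) by blast
  qed
  then obtain h' where h': "\<And>x. x \<in> T \<Longrightarrow> (h has_derivative h' x) (at x)"
    "\<And>x v. x \<in> T \<Longrightarrow> A x (h' x v) = - frechet_derivative E (at (x, h x)) (v, 0)" by metis
  have "Ck_on j T h" if "j \<le> Suc k" for j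
    using that
  proof (induction j)
    case 0
    then show ?case using S(3) T(4) by (auto intro: continuous_on_subset)
  next
    case (Suc j)
    have "Ck_on j T h" using Suc by simp
    then have g: "Ck_on j T (\<lambda>x. (x, h x))"
      using Ck_on_Pair[OF T(2) Ck_on_bounded_linear[OF bounded_linear_ident T(2)]] by blast
    have comp: "Ck_on j T (\<lambda>x. frechet_derivative E (at (x, h x)) v)" for v
      by (rule Ck_on_compose[OF T(2) Ck_on_mono[OF E'(2)] g]) (use Suc.prems W T(4) in auto)
    show ?case
    proof (rule Ck_on_SucI[OF T(2) h'(1)])
      show "Ck_on j T (\<lambda>x. h' x v)" for v
      proof (rule Ck_on_linear_solve[OF T(2) _ injT _ _ h'(2)])
        show "linear (A x)" if "x \<in> T" for x using lin that T(4) by blast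
        show "Ck_on j T (\<lambda>x. A x e)" for e unfolding A_def by (rule comp)
        show "Ck_on j T (\<lambda>x. - frechet_derivative E (at (x, h x)) (v, 0))"
          by (rule Ck_on_bounded_linear_compose[OF bounded_linear_minus[OF bounded_linear_ident] T(2) comp])
      qed
    qed
  qed
  then show ?thesis using that[OF T(2-4)] by blast
qed

text \<open>The inverse function theorem is used only for a continuous inverse. That inverse solves
  \<open>f y - z = 0\<close> with unknown \<open>y\<close>, whose partial derivative in
  \<open>y\<close> is the derivative of \<open>f\<close>, so its smoothness is an instance of
  \<open>Ck_on_implicit\<close>. The left-inverse property is stated near \<open>x0\<close> because
  the domain of \<open>g\<close> shrinks on the way.\<close>

lemma Ck_on_local_inverse:
  fixes f :: "'a::euclidean_space \<Rightarrow> 'a"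
  assumes "open U" "x0 \<in> U" and f: "Ck_on (Suc k) U f"
    and inj: "inj (frechet_derivative f (at x0))"
  obtains V g where "open V" "f x0 \<in> V" "Ck_on (Suc k) V g" "\<And>z. z \<in> V \<Longrightarrow> f (g z) = z"
    "\<forall>\<^sub>F y in nhds x0. f y \<in> V \<and> g (f y) = y"
proof -
  note f' = Ck_on_SucD[OF f]
  \<comment> \<open>The inverse function theorem asks for a derivative that is continuous as an
    operator-valued map; in finite dimensions this is continuity of every column.\<close>
  define F where "F x = Blinfun (frechet_derivative f (at x))" for x
  have F: "blinfun_apply (F x) = frechet_derivative f (at x)" if "x \<in> U" for x
    unfolding F_def by (rule bounded_linear_Blinfun_apply[OF has_derivative_bounded_linear[OF f'(1)[OF that]]])
  have derF: "(f has_derivative blinfun_apply (F x)) (at x)" if "x \<in> U" for x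
    using f'(1)[OF that] F[OF that] by simp
  have contF: "continuous_on U F"
    by (rule continuous_on_blinfun_componentwise)
      (use Ck_on_imp_continuous_on[OF f'(2)] F in \<open>simp cong: continuous_on_cong\<close>)
  obtain Li where Li: "linear Li" "\<And>w. Li (frechet_derivative f (at x0) w) = w"
    using linear_injective_isomorphism[OF has_derivative_linear[OF f'(1)[OF \<open>x0 \<in> U\<close>]] inj] by blast
  have "Blinfun Li o\<^sub>L F x0 = id_blinfun"
    by (rule blinfun_eqI)
      (simp add: F[OF \<open>x0 \<in> U\<close>] Li bounded_linear_Blinfun_apply linear_conv_bounded_linear[THEN iffD1])
  then obtain U' V g where U': "open U'" "U' \<subseteq> U" "x0 \<in> U'" and V: "open V" "f x0 \<in> V"
    and hom: "homeomorphism U' V f g"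
    using inverse_function_theorem[OF \<open>open U\<close> derF contF \<open>x0 \<in> U\<close>] by metis
  have gf: "g (f y) = y" if "y \<in> U'" for y using homeomorphism_apply1[OF hom that] .
  have fg: "f (g z) = z" "g z \<in> U'" if "z \<in> V" for z
    using homeomorphism_apply2[OF hom that] homeomorphism_image2[OF hom] that by auto
  have id: "bounded_linear (\<lambda>p. fst p :: 'a)" "bounded_linear (\<lambda>p. snd p :: 'a)"
    by (rule bounded_linear_fst bounded_linear_snd)+
  define E where "E = (\<lambda>p. f (snd p) - fst p)"
  have opn: "open (UNIV \<times> U)" using \<open>open U\<close> by (simp add: open_Times)
  have E: "Ck_on (Suc k) (UNIV \<times> U) E"
    unfolding E_def
    by (intro Ck_on_diff Ck_on_compose[OF opn f] Ck_on_bounded_linear id opn) auto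
  have "(f has_derivative frechet_derivative f (at x0)) (at (snd (f x0, g (f x0))))"
    using f'(1)[OF \<open>x0 \<in> U\<close>] gf[OF U'(3)] by simp
  from has_derivative_compose[OF bounded_linear_imp_has_derivative[OF id(2)] this]
  have "(E has_derivative (\<lambda>p. frechet_derivative f (at x0) (snd p) - fst p)) (at (f x0, g (f x0)))"
    unfolding E_def
    by (rule has_derivative_diff) (rule bounded_linear_imp_has_derivative[OF id(1)])
  then have "frechet_derivative E (at (f x0, g (f x0))) = (\<lambda>p. frechet_derivative f (at x0) (snd p) - fst p)"
    by (rule frechet_derivative_at[symmetric])
  then have injE: "inj (\<lambda>w. frechet_derivative E (at (f x0, g (f x0))) (0, w))"
    using inj by simp
  obtain T where T: "open T" "f x0 \<in> T" "T \<subseteq> V" "Ck_on (Suc k) T g"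
    by (rule Ck_on_implicit[OF E V homeomorphism_cont2[OF hom] _ _ injE])
      (use fg U'(2) in \<open>auto simp: E_def\<close>)
  show ?thesis
  proof (rule that[OF T(1,2,4)])
    show "f (g z) = z" if "z \<in> T" for z using fg that T(3) by auto
    have "isCont f x0" using derF[OF \<open>x0 \<in> U\<close>] by (rule has_derivative_continuous)
    then have "\<forall>\<^sub>F y in nhds x0. f y \<in> T"
      unfolding isCont_def tendsto_at_iff_tendsto_nhds[of f] using T(1,2) by (rule topological_tendstoD)
    then show "\<forall>\<^sub>F y in nhds x0. f y \<in> T \<and> g (f y) = y"
      using eventually_nhds_in_open[OF U'(1,3)] by eventually_elim (simp add: gf)
  qed
qed

section \<open>Minimizers on a manifold\<close>

lemma orthonormal_expansion:
  fixes B :: "'a::euclidean_space set"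
  assumes "finite B" "pairwise orthogonal B" "\<And>b. b \<in> B \<Longrightarrow> norm b = 1"
  shows "b' \<in> B \<Longrightarrow> (\<Sum>b\<in>B. (v \<bullet> b) *\<^sub>R b) \<bullet> b' = v \<bullet> b'"
    and "v \<in> span B \<Longrightarrow> (\<Sum>b\<in>B. (v \<bullet> b) *\<^sub>R b) = v"
proof -
  have inner: "b \<bullet> b' = (if b = b' then 1 else 0)" if "b \<in> B" "b' \<in> B" for b b'
    using assms(2,3) that by (auto simp: pairwise_def orthogonal_def dot_square_norm)
  show *: "(\<Sum>b\<in>B. (v \<bullet> b) *\<^sub>R b) \<bullet> b' = v \<bullet> b'" if "b' \<in> B" for b' v
  proof -
    have "(\<Sum>b\<in>B. (v \<bullet> b) *\<^sub>R b) \<bullet> b' = (\<Sum>b\<in>B. if b = b' then v \<bullet> b else 0)"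
      unfolding inner_sum_left by (intro sum.cong) (auto simp: inner that)
    then show ?thesis using \<open>finite B\<close> that by simp
  qed
  assume v: "v \<in> span B"
  define y where "y = v - (\<Sum>b\<in>B. (v \<bullet> b) *\<^sub>R b)"
  have "y \<in> span B"
    unfolding y_def by (rule span_diff[OF v span_sum]) (rule span_mul[OF span_base])
  moreover have "orthogonal y b" if "b \<in> B" for b
    using *[OF that] by (simp add: y_def orthogonal_def inner_diff_left)
  ultimately have "orthogonal y y" by (metis orthogonal_to_span)
  then show "(\<Sum>b\<in>B. (v \<bullet> b) *\<^sub>R b) = v" by (simp add: orthogonal_self y_def)
qed

text \<open>If \<phi>' and \<phi>'' vanish at 0, then \<phi>'(t) = o(t), and the mean value theorem
  leaves at most (c/2) t^2 of growth. The second derivative has to exist at 0 only.\<close>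

lemma second_derivative_zero_imp_no_quadratic_growth:
  fixes \<phi> :: "real \<Rightarrow> real"
  assumes d: "\<forall>\<^sub>F t in nhds 0. (\<phi> has_real_derivative \<phi>' t) (at t)"
    and "\<phi>' 0 = 0" and d2: "(\<phi>' has_real_derivative 0) (at 0)"
    and growth: "\<forall>\<^sub>F t in nhds 0. \<phi> 0 + c * t\<^sup>2 \<le> \<phi> t"
  shows "c \<le> 0"
proof (rule ccontr)
  assume "\<not> c \<le> 0"
  then have "c > 0" by simp
  obtain r where r: "r > 0" "\<And>t. norm t < r \<Longrightarrow> \<bar>\<phi>' t\<bar> \<le> c / 2 * \<bar>t\<bar>"
    using d2 \<open>\<phi>' 0 = 0\<close> \<open>c > 0\<close> unfolding has_field_derivative_def has_derivative_at_alt
    by (force dest: spec[of _ "c / 2"])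
  obtain s where s: "s > 0" "\<And>t. \<bar>t\<bar> < s \<Longrightarrow> (\<phi> has_real_derivative \<phi>' t) (at t)"
    "\<And>t. \<bar>t\<bar> < s \<Longrightarrow> \<phi> 0 + c * t\<^sup>2 \<le> \<phi> t"
    using eventually_conj[OF d growth] by (auto simp: eventually_nhds_metric dist_norm)
  define t where "t = min r s / 2"
  have t: "0 < t" "t < r" "t < s" using r(1) s(1) by (auto simp: t_def)
  obtain \<xi> where \<xi>: "0 < \<xi>" "\<xi> < t" "\<phi> t - \<phi> 0 = (t - 0) * \<phi>' \<xi>"
    using MVT2[OF t(1), of \<phi> \<phi>'] s(2) t by auto
  have "\<phi>' \<xi> \<le> c / 2 * \<xi>" using r(2)[of \<xi>] \<xi> t by auto
  also have "\<dots> \<le> c / 2 * t" using \<xi> \<open>c > 0\<close> by (intro mult_left_mono) auto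
  finally have "\<phi> t - \<phi> 0 \<le> t * (c / 2 * t)" using \<xi>(3) t(1) by simp
  also have "\<dots> < c * t\<^sup>2" using \<open>c > 0\<close> t(1) by (simp add: power2_eq_square)
  finally show False using s(3)[of t] t by simp
qed

text \<open>The first-order condition along \<open>span B\<close>, together with \<open>u \<in> span B\<close>, is one equation in the
  whole space; quadratic growth makes its derivative in \<open>u\<close> injective.\<close>

lemma Ck_on_argmin_on_span:
  fixes f :: "'a::euclidean_space \<times> 'b::euclidean_space \<Rightarrow> real"
  assumes "open W" and f: "Ck_on (Suc (Suc k)) W f"
    and S: "open S" "x0 \<in> S" "continuous_on S h"
    and W: "\<And>x. x \<in> S \<Longrightarrow> (x, h x) \<in> W"
    and B: "finite B" "pairwise orthogonal B" "\<And>b. b \<in> B \<Longrightarrow> norm b = 1"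
    and hB: "\<And>x. x \<in> S \<Longrightarrow> h x \<in> span B"
    and locmin: "\<And>x. x \<in> S \<Longrightarrow> \<forall>\<^sub>F u in nhds (h x). u \<in> span B \<longrightarrow> f (x, h x) \<le> f (x, u)"
    and "c > 0"
    and growth: "\<forall>\<^sub>F u in nhds (h x0). u \<in> span B \<longrightarrow>
      f (x0, h x0) + c * (norm (u - h x0))\<^sup>2 \<le> f (x0, u)"
  obtains T where "open T" "x0 \<in> T" "T \<subseteq> S" "Ck_on (Suc k) T h"
proof -
  note f' = Ck_on_SucD[OF f]
  define D where "D v z = frechet_derivative f (at z) (0, v)" for v z
  have DC: "Ck_on (Suc k) W (D v)" for v unfolding D_def by (rule f'(2))
  note D' = Ck_on_SucD[OF DC]
  have linD: "linear (\<lambda>v. D v z)" if "z \<in> W" for z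
  proof -
    have "bounded_linear (\<lambda>v. frechet_derivative f (at z) (0, v))"
      by (intro bounded_linear_compose[OF has_derivative_bounded_linear[OF f'(1)[OF that]]]
          bounded_linear_Pair bounded_linear_ident bounded_linear_zero)
    then show ?thesis unfolding D_def by (rule bounded_linear.linear)
  qed
  have path: "((\<lambda>t. f (x, u + t *\<^sub>R v)) has_real_derivative D v (x, u + t *\<^sub>R v)) (at t)"
    if "(x, u + t *\<^sub>R v) \<in> W" for x u v t
  proof -
    have "((\<lambda>t. (x, u + t *\<^sub>R v)) has_derivative (\<lambda>s. (0, s *\<^sub>R v))) (at t)"
      by (auto intro!: derivative_eq_intros)
    from has_derivative_compose[OF this f'(1)[OF that]]
    have "((\<lambda>t. f (x, u + t *\<^sub>R v)) has_derivative (\<lambda>s. D (s *\<^sub>R v) (x, u + t *\<^sub>R v))) (at t)"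
      by (simp add: D_def)
    then show ?thesis
      by (simp add: has_field_derivative_def linear_scale[OF linD[OF that]] mult_commute_abs)
  qed
  have path_nhds: "\<forall>\<^sub>F t in nhds 0. Q (u + t *\<^sub>R v)" if "\<forall>\<^sub>F y in nhds u. Q y"
    for u v :: 'b and Q
  proof -
    have "((\<lambda>t::real. u + t *\<^sub>R v) \<longlongrightarrow> u + 0 *\<^sub>R v) (nhds 0)"
      by (intro tendsto_intros filterlim_ident)
    then show ?thesis using that unfolding filterlim_iff by simp
  qed
  have D0: "D v (x, h x) = 0" if "x \<in> S" "v \<in> span B" for x v
  proof -
    have "\<forall>\<^sub>F t in nhds 0. h x + t *\<^sub>R v \<in> span B \<longrightarrow> f (x, h x) \<le> f (x, h x + t *\<^sub>R v)"
      by (rule path_nhds[OF locmin[OF \<open>x \<in> S\<close>]])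
    then have "\<forall>\<^sub>F t in nhds 0. f (x, h x) \<le> f (x, h x + t *\<^sub>R v)"
      using that hB by (simp add: span_add span_mul)
    then have "\<forall>\<^sub>F t in at 0. f (x, h x + 0 *\<^sub>R v) \<le> f (x, h x + t *\<^sub>R v)"
      by (simp add: eventually_nhds_conv_at)
    moreover have "((\<lambda>t. f (x, h x + t *\<^sub>R v)) has_real_derivative D v (x, h x)) (at 0)"
      using path[of x "h x" 0 v] W[OF that(1)] by simp
    ultimately have "(*) (D v (x, h x)) = (\<lambda>h. 0)"
      unfolding has_field_derivative_def by (intro has_derivative_local_min)
    then show ?thesis by (metis mult.right_neutral)
  qed
  define P where "P v = (\<Sum>b\<in>B. (v \<bullet> b) *\<^sub>R b)" for v
  have bP: "bounded_linear P"
    unfolding P_def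
    by (intro bounded_linear_sum bounded_linear_scaleR_const bounded_linear_inner_left)
  have P_id: "P v = v" if "v \<in> span B" for v
    unfolding P_def by (rule orthonormal_expansion(2)[OF B that])
  have P_inner: "P v \<bullet> b = v \<bullet> b" if "b \<in> B" for v b
    unfolding P_def by (rule orthonormal_expansion(1)[OF B that])
  \<comment> \<open>The first summand lies in \<open>span B\<close>, the second in its orthogonal
    complement. They cannot cancel, so \<open>E z = 0\<close> means that the first-order condition
    holds and that \<open>snd z\<close> lies in \<open>span B\<close>.\<close>
  define E where "E z = (\<Sum>b\<in>B. D b z *\<^sub>R b) + (snd z - P (snd z))" for z
  have E: "Ck_on (Suc k) W E"
    unfolding E_def
    by (intro Ck_on_add[OF \<open>open W\<close>] Ck_on_sum[OF \<open>open W\<close>] Ck_on_diff[OF \<open>open W\<close>]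
        Ck_on_scaleR[OF \<open>open W\<close> DC Ck_on_const[OF \<open>open W\<close>]]
        Ck_on_bounded_linear[OF bounded_linear_snd \<open>open W\<close>]
        Ck_on_bounded_linear[OF bounded_linear_compose[OF bP bounded_linear_snd] \<open>open W\<close>])
  define z0 where "z0 = (x0, h x0)"
  have z0: "z0 \<in> W" using W[OF S(2)] by (simp add: z0_def)
  define C where "C b w = frechet_derivative (D b) (at z0) (0, w)" for b w
  have "(E has_derivative (\<lambda>p. (\<Sum>b\<in>B. frechet_derivative (D b) (at z0) p *\<^sub>R b)
      + (snd p - P (snd p)))) (at z0)"
    unfolding E_def
    by (intro has_derivative_add has_derivative_sum has_derivative_scaleR_left has_derivative_diff
        bounded_linear_imp_has_derivative[OF bounded_linear_snd]
        bounded_linear_imp_has_derivative[OF bounded_linear_compose[OF bP bounded_linear_snd]] D'(1) z0)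
  from frechet_derivative_at[OF this]
  have E': "frechet_derivative E (at z0) (0, w) = (\<Sum>b\<in>B. C b w *\<^sub>R b) + (w - P w)" for w
    by (auto simp: C_def dest: fun_cong[where x = "(0, w)"])
  have inj: "inj (\<lambda>w. frechet_derivative E (at z0) (0, w))"
  proof -
    have "bounded_linear (\<lambda>w. frechet_derivative E (at z0) (0, w))"
      by (intro bounded_linear_compose[OF has_derivative_bounded_linear[OF Ck_on_SucD(1)[OF E z0]]]
          bounded_linear_Pair bounded_linear_ident bounded_linear_zero)
    then have lin: "linear (\<lambda>w. frechet_derivative E (at z0) (0, w))" by (rule bounded_linear.linear)
    have "w = 0" if "frechet_derivative E (at z0) (0, w) = 0" for w
    proof (rule ccontr)
      assume "w \<noteq> 0"
      have eq: "(\<Sum>b\<in>B. C b w *\<^sub>R b) + (w - P w) = 0" using that E' by simp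
      have orth: "b \<bullet> (w - P w) = 0" if "b \<in> B" for b
        using P_inner[OF that, of w] by (simp add: inner_diff_right inner_commute)
      \<comment> \<open>Pairing with the orthogonal part of \<open>w\<close> removes the first
        summand and puts a kernel vector into \<open>span B\<close>.\<close>
      have "((\<Sum>b\<in>B. C b w *\<^sub>R b) + (w - P w)) \<bullet> (w - P w) = (w - P w) \<bullet> (w - P w)"
        by (simp add: inner_add_left inner_sum_left orth)
      then have Pw: "P w = w" using eq by simp
      then have wB: "w \<in> span B"
        unfolding P_def by (metis (no_types, lifting) span_base span_mul span_sum)
      have Dw: "D w z = (\<Sum>b\<in>B. (w \<bullet> b) * D b z)" if "z \<in> W" for z
      proof -
        have "D (P w) z = (\<Sum>b\<in>B. (w \<bullet> b) *\<^sub>R D b z)"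
          unfolding P_def by (simp only: linear_sum[OF linD[OF that]] linear_scale[OF linD[OF that]])
        then show ?thesis by (simp add: Pw)
      qed
      \<comment> \<open>Pairing with \<open>w\<close> itself produces the second derivative of
        \<open>f (x0, _)\<close> at \<open>h x0\<close> in direction \<open>w\<close>. It vanishes
        on the kernel, against the quadratic growth on the line through \<open>h x0\<close>.\<close>
      have "((\<Sum>b\<in>B. C b w *\<^sub>R b) + (w - P w)) \<bullet> w = (\<Sum>b\<in>B. (w \<bullet> b) * C b w)"
        by (simp add: Pw inner_sum_left inner_commute[of w] mult.commute)
      then have sum0: "(\<Sum>b\<in>B. (w \<bullet> b) * C b w) = 0" using eq by simp
      have line: "((\<lambda>t. (x0, h x0 + t *\<^sub>R w)) has_derivative (\<lambda>s. (0, s *\<^sub>R w))) (at 0)"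
        by (auto intro!: derivative_eq_intros)
      have "((\<lambda>z. \<Sum>b\<in>B. (w \<bullet> b) * D b z) has_derivative
          (\<lambda>p. \<Sum>b\<in>B. (w \<bullet> b) * frechet_derivative (D b) (at z0) p)) (at z0)"
        by (intro has_derivative_sum has_derivative_mult_right D'(1) z0)
      then have "(D w has_derivative (\<lambda>p. \<Sum>b\<in>B. (w \<bullet> b) * frechet_derivative (D b) (at z0) p)) (at z0)"
        by (rule has_derivative_transform_within_open[OF _ \<open>open W\<close> z0]) (simp add: Dw)
      then have dDw: "(D w has_derivative (\<lambda>p. \<Sum>b\<in>B. (w \<bullet> b) * frechet_derivative (D b) (at z0) p))
          (at (x0, h x0 + 0 *\<^sub>R w))" by (simp add: z0_def)
      have "((\<lambda>t. D w (x0, h x0 + t *\<^sub>R w)) has_derivative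
          (\<lambda>s. \<Sum>b\<in>B. (w \<bullet> b) * frechet_derivative (D b) (at z0) (0, s *\<^sub>R w))) (at 0)"
        by (rule has_derivative_compose[OF line dDw])
      moreover have "(\<Sum>b\<in>B. (w \<bullet> b) * frechet_derivative (D b) (at z0) (0, s *\<^sub>R w)) = 0" for s
      proof -
        have "frechet_derivative (D b) (at z0) (0, s *\<^sub>R w) = s * C b w" for b
          using linear_scale[OF has_derivative_linear[OF D'(1)[OF z0]], of b s "(0, w)"]
          by (simp add: C_def)
        then have "(\<Sum>b\<in>B. (w \<bullet> b) * frechet_derivative (D b) (at z0) (0, s *\<^sub>R w))
            = s * (\<Sum>b\<in>B. (w \<bullet> b) * C b w)"
          by (simp add: sum_distrib_left mult_ac)
        then show ?thesis by (simp add: sum0)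
      qed
      moreover have "(*) (0::real) = (\<lambda>s. 0)" by auto
      ultimately have d2: "((\<lambda>t. D w (x0, h x0 + t *\<^sub>R w)) has_real_derivative 0) (at 0)"
        by (simp only: has_field_derivative_def)
      have "\<forall>\<^sub>F u in nhds (h x0). (x0, u) \<in> W"
      proof -
        have "((\<lambda>u. (x0, u)) \<longlongrightarrow> (x0, h x0)) (nhds (h x0))" by (intro tendsto_intros filterlim_ident)
        then show ?thesis using \<open>open W\<close> W[OF S(2)] by (rule topological_tendstoD)
      qed
      then have "\<forall>\<^sub>F t in nhds 0. (x0, h x0 + t *\<^sub>R w) \<in> W" by (rule path_nhds)
      then have d1: "\<forall>\<^sub>F t in nhds 0. ((\<lambda>t. f (x0, h x0 + t *\<^sub>R w)) has_real_derivative
          D w (x0, h x0 + t *\<^sub>R w)) (at t)"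
        by eventually_elim (rule path)
      have "\<forall>\<^sub>F t in nhds 0. h x0 + t *\<^sub>R w \<in> span B \<longrightarrow>
          f (x0, h x0) + c * (norm (h x0 + t *\<^sub>R w - h x0))\<^sup>2 \<le> f (x0, h x0 + t *\<^sub>R w)"
        by (rule path_nhds[OF growth])
      then have g: "\<forall>\<^sub>F t in nhds 0. f (x0, h x0 + 0 *\<^sub>R w) + (c * (norm w)\<^sup>2) * t\<^sup>2
          \<le> f (x0, h x0 + t *\<^sub>R w)"
        using hB[OF S(2)] wB by (simp add: span_add span_mul power_mult_distrib mult_ac)
      have "c * (norm w)\<^sup>2 \<le> 0"
        by (rule second_derivative_zero_imp_no_quadratic_growth[OF d1 _ d2 g])
          (simp add: D0[OF S(2) wB])
      then show False using \<open>c > 0\<close> \<open>w \<noteq> 0\<close> by (simp add: mult_le_0_iff)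
    qed
    then show ?thesis using linear_injective_0[OF lin] by blast
  qed
  have zero: "E (x, h x) = 0" if "x \<in> S" for x
    using D0[OF that span_base] P_id[OF hB[OF that]] by (simp add: E_def)
  show ?thesis
    using Ck_on_implicit[OF E S W zero inj[unfolded z0_def]] that by blast
qed

text \<open>\<Psi> combines the projection of \<open>y - z\<close> to the tangent space with the
  defining functions placed along their gradients. Its derivative at \<open>z\<close>, paired with
  \<open>v\<close>, is the sum of the squares of the tangential coordinates and of the numbers
  \<open>dG i v\<close>, which gives injectivity. If \<Psi> y is tangent, the gradient part is both
  tangent and normal, hence 0, and full rank then yields \<open>G i y = 0\<close> for each
  \<open>i\<close>.\<close>

lemma manifold_straightening:
  fixes G :: "nat \<Rightarrow> 'a::euclidean_space \<Rightarrow> real"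
  assumes G: "\<And>i. i < q \<Longrightarrow> Ck_on (Suc k) UNIV (G i)" and rank: "full_row_rank_at q G z"
    and "\<epsilon> > 0" "M \<inter> ball z \<epsilon> = {y \<in> ball z \<epsilon>. \<forall>i<q. G i y = 0}" "z \<in> M"
  obtains B \<Psi> V \<theta> where "finite B" "pairwise orthogonal B" "\<And>b::'a. b \<in> B \<Longrightarrow> norm b = 1"
    "Ck_on (Suc k) UNIV \<Psi>" "open V" "\<Psi> z \<in> V" "Ck_on (Suc k) V \<theta>"
    "\<And>u. u \<in> V \<Longrightarrow> \<Psi> (\<theta> u) = u" "\<forall>\<^sub>F y in nhds z. \<Psi> y \<in> V \<and> \<theta> (\<Psi> y) = y"
    "\<And>y. y \<in> ball z \<epsilon> \<Longrightarrow> y \<in> M \<longleftrightarrow> \<Psi> y \<in> span B"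
proof -
  have M: "y \<in> M \<longleftrightarrow> (\<forall>i<q. G i y = 0)" if "y \<in> ball z \<epsilon>" for y
    using assms(4) that by blast
  define dG where "dG i = frechet_derivative (G i) (at z)" for i
  have dG: "(G i has_derivative dG i) (at z)" if "i < q" for i
    unfolding dG_def by (rule Ck_on_SucD(1)[OF G[OF that] UNIV_I])
  \<comment> \<open>\<open>g i\<close> is the gradient of \<open>G i\<close> at
    \<open>z\<close>.\<close>
  define g where "g i = (\<Sum>e\<in>Basis. dG i e *\<^sub>R e)" for i
  have g: "g i \<bullet> v = dG i v" if "i < q" for i v
    using linear_expand[OF has_derivative_linear[OF dG[OF that]], of v]
    by (simp add: g_def inner_sum_left inner_commute[of v] mult.commute)
  define T where "T = {v. \<forall>i<q. g i \<bullet> v = 0}"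
  have "subspace T"
    by (auto simp: T_def subspace_def inner_add_right)
  then obtain B where B: "pairwise orthogonal B" "\<And>b. b \<in> B \<Longrightarrow> norm b = 1" "independent B" "span B = T"
    using orthonormal_basis_subspace by metis
  then have fB: "finite B" using independent_imp_finite by blast
  define P where "P v = (\<Sum>b\<in>B. (v \<bullet> b) *\<^sub>R b)" for v
  have P_id: "P v = v" if "v \<in> T" for v
    unfolding P_def using orthonormal_expansion(2)[OF fB B(1,2)] that B(4) by blast
  have P_T: "P v \<in> T" for v
    unfolding P_def B(4)[symmetric] by (rule span_sum) (rule span_mul[OF span_base])
  have bP: "bounded_linear P"
    unfolding P_def
    by (intro bounded_linear_sum bounded_linear_scaleR_const bounded_linear_inner_left)
  define \<Psi> where "\<Psi> y = P (y - z) + (\<Sum>i<q. G i y *\<^sub>R g i)" for y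
  have C\<Psi>: "Ck_on (Suc k) UNIV \<Psi>"
    unfolding \<Psi>_def
    by (intro Ck_on_add[OF open_UNIV] Ck_on_sum[OF open_UNIV] Ck_on_scaleR[OF open_UNIV]
        Ck_on_bounded_linear_compose[OF bP open_UNIV] Ck_on_diff[OF open_UNIV] Ck_on_const[OF open_UNIV]
        Ck_on_bounded_linear[OF bounded_linear_ident open_UNIV] G) auto
  have "(\<Psi> has_derivative (\<lambda>v. P (v - 0) + (\<Sum>i<q. dG i v *\<^sub>R g i))) (at z)"
    unfolding \<Psi>_def
    by (intro has_derivative_add has_derivative_sum has_derivative_scaleR_left has_derivative_diff
        bounded_linear.has_derivative[OF bP] has_derivative_ident has_derivative_const dG) auto
  then have d\<Psi>: "(\<Psi> has_derivative (\<lambda>v. P v + (\<Sum>i<q. dG i v *\<^sub>R g i))) (at z)"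
    by simp
  have "v = 0" if "P v + (\<Sum>i<q. dG i v *\<^sub>R g i) = 0" for v
  proof -
    have "(P v + (\<Sum>i<q. dG i v *\<^sub>R g i)) \<bullet> v = (\<Sum>b\<in>B. (v \<bullet> b)\<^sup>2) + (\<Sum>i<q. (dG i v)\<^sup>2)"
      by (simp add: P_def inner_add_left inner_sum_left g power2_eq_square inner_commute[of v])
    then have "(\<Sum>b\<in>B. (v \<bullet> b)\<^sup>2) + (\<Sum>i<q. (dG i v)\<^sup>2) = 0" using that by simp
    moreover have "(\<Sum>b\<in>B. (v \<bullet> b)\<^sup>2) \<ge> 0" "(\<Sum>i<q. (dG i v)\<^sup>2) \<ge> 0" by (simp_all add: sum_nonneg)
    ultimately have "(\<Sum>b\<in>B. (v \<bullet> b)\<^sup>2) = 0" "(\<Sum>i<q. (dG i v)\<^sup>2) = 0" by linarith+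
    then have 1: "\<forall>b\<in>B. v \<bullet> b = 0" and "\<forall>i<q. dG i v = 0"
      using fB by (auto simp: sum_nonneg_eq_0_iff)
    then have "v \<in> T" by (simp add: T_def g)
    then have "v = P v" by (simp add: P_id)
    also have "P v = 0" using 1 by (simp add: P_def)
    finally show "v = 0" .
  qed
  then have "inj (\<lambda>v. P v + (\<Sum>i<q. dG i v *\<^sub>R g i))"
    using linear_injective_0[OF has_derivative_linear[OF d\<Psi>]] by blast
  then have inj: "inj (frechet_derivative \<Psi> (at z))"
    using frechet_derivative_at[OF d\<Psi>] by simp
  obtain V \<theta> where V: "open V" "\<Psi> z \<in> V" "Ck_on (Suc k) V \<theta>" "\<And>u. u \<in> V \<Longrightarrow> \<Psi> (\<theta> u) = u"
    "\<forall>\<^sub>F y in nhds z. \<Psi> y \<in> V \<and> \<theta> (\<Psi> y) = y"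
    by (rule Ck_on_local_inverse[OF open_UNIV UNIV_I C\<Psi> inj]) blast
  have "y \<in> M \<longleftrightarrow> \<Psi> y \<in> span B" if "y \<in> ball z \<epsilon>" for y
  proof
    assume "y \<in> M"
    then show "\<Psi> y \<in> span B" using M[OF that] P_T B(4) by (simp add: \<Psi>_def)
  next
    assume "\<Psi> y \<in> span B"
    then have "\<Psi> y - P (y - z) \<in> T" using P_T \<open>subspace T\<close> B(4) subspace_diff by blast
    then have n: "(\<Sum>i<q. G i y *\<^sub>R g i) \<in> T" by (simp add: \<Psi>_def)
    then have "(\<Sum>i<q. G i y *\<^sub>R g i) \<bullet> (\<Sum>i<q. G i y *\<^sub>R g i) = 0"
      by (subst inner_sum_left) (simp add: T_def)
    then have "(\<Sum>i<q. G i y *\<^sub>R g i) = 0" by simp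
    then have "(\<Sum>i<q. G i y * dG i v) = 0" for v
      using inner_sum_left[of "\<lambda>i. G i y *\<^sub>R g i" "{..<q}" v] by (simp add: g)
    then show "y \<in> M"
      using spec[OF rank[unfolded full_row_rank_at_def], of "\<lambda>i. G i y"] M[OF that]
      by (simp add: dG_def)
  qed
  then show ?thesis using that[OF fB B(1,2) C\<Psi> V] by blast
qed

text \<open>In straightened coordinates \<open>h = \<Psi> \<circ> H\<close> minimizes
  \<open>f\<close> locally over \<open>span B\<close>, and \<open>H = \<theta> \<circ> h\<close>
  recovers the map. Quadratic growth survives the change of coordinates because \<Psi> is Lipschitz
  near \<open>z\<close>: distances in the new coordinates are at most \<open>L'\<close> times the
  old ones, hence the constant \<open>c / L'\<^sup>2\<close>.\<close>

lemma Ck_on_argmin_on_manifold: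
  fixes H :: "'a::euclidean_space \<Rightarrow> 'a" and \<sigma> :: "'a \<times> 'a \<Rightarrow> real"
  assumes G: "\<And>i. i < q \<Longrightarrow> Ck_on (Suc (Suc k)) UNIV (G i)" and rank: "full_row_rank_at q G z"
    and "\<epsilon> > 0" and M: "M \<inter> ball z \<epsilon> = {y \<in> ball z \<epsilon>. \<forall>i<q. G i y = 0}" "z \<in> M"
    and U: "open U" "(z, z) \<in> U" and \<sigma>: "Ck_on (Suc (Suc k)) U \<sigma>"
    and H: "continuous_on UNIV H" "H z = z" and HM: "\<forall>\<^sub>F x in nhds z. H x \<in> M"
    and "r > 0" and min: "\<And>x y. x \<in> ball z r \<Longrightarrow> H x \<in> M \<inter> ball z r \<Longrightarrow> y \<in> M \<inter> ball z r \<Longrightarrow>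
      \<sigma> (x, H x) \<le> \<sigma> (x, y)"
    and "c > 0" and growth: "\<forall>\<^sub>F y in nhds z. y \<in> M \<longrightarrow> \<sigma> (z, z) + c * (norm (y - z))\<^sup>2 \<le> \<sigma> (z, y)"
  obtains T where "open T" "z \<in> T" "Ck_on (Suc k) T H"
proof -
  obtain B \<Psi> V \<theta> where B: "finite B" "pairwise orthogonal B" "\<And>b::'a. b \<in> B \<Longrightarrow> norm b = 1"
    and \<Psi>: "Ck_on (Suc (Suc k)) UNIV \<Psi>" and V: "open V" "\<Psi> z \<in> V"
    and \<theta>: "Ck_on (Suc (Suc k)) V \<theta>"
    and \<Psi>\<theta>: "\<And>u. u \<in> V \<Longrightarrow> \<Psi> (\<theta> u) = u" and \<theta>\<Psi>: "\<forall>\<^sub>F y in nhds z. \<Psi> y \<in> V \<and> \<theta> (\<Psi> y) = y"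
    and MB: "\<And>y. y \<in> ball z \<epsilon> \<Longrightarrow> y \<in> M \<longleftrightarrow> \<Psi> y \<in> span B"
    by (rule manifold_straightening[OF G rank \<open>\<epsilon> > 0\<close> M]) blast+
  have isCont_H: "isCont H x" for x using H(1) by (simp add: continuous_on_eq_continuous_at)
  have cont\<Psi>: "continuous_on UNIV \<Psi>" using \<Psi> by (rule Ck_on_imp_continuous_on)
  have cont\<theta>: "continuous_on V \<theta>" using \<theta> by (rule Ck_on_imp_continuous_on)
  define \<epsilon>' where "\<epsilon>' = min \<epsilon> r"
  have \<epsilon>': "\<epsilon>' > 0" "ball z \<epsilon>' \<subseteq> ball z \<epsilon>" "ball z \<epsilon>' \<subseteq> ball z r"
    using \<open>\<epsilon> > 0\<close> \<open>r > 0\<close> by (auto simp: \<epsilon>'_def)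
  have H_lim: "(H \<longlongrightarrow> z) (nhds z)"
    using isCont_H[of z] H(2) tendsto_at_iff_tendsto_nhds[of H z] by (simp add: isCont_def)
  define h where "h x = \<Psi> (H x)" for x
  define W where "W = (UNIV \<times> V) \<inter> (\<lambda>p. (fst p, \<theta> (snd p))) -` U"
  have opV: "open (UNIV \<times> V :: ('a \<times> 'a) set)" using V(1) by (simp add: open_Times)
  have C\<theta>: "Ck_on (Suc (Suc k)) (UNIV \<times> V) (\<lambda>p. (fst p :: 'a, \<theta> (snd p)))"
    by (rule Ck_on_Pair[OF opV Ck_on_bounded_linear[OF bounded_linear_fst opV]
          Ck_on_compose[OF opV \<theta> Ck_on_bounded_linear[OF bounded_linear_snd opV]]]) auto
  have "open W"
    unfolding W_def
    using continuous_on_open_vimage[OF opV] Ck_on_imp_continuous_on[OF C\<theta>] U(1)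
    by (metis Int_commute)
  define f where "f p = \<sigma> (fst p, \<theta> (snd p))" for p
  have f: "Ck_on (Suc (Suc k)) W f"
    unfolding f_def
    by (rule Ck_on_compose[OF \<open>open W\<close> \<sigma> Ck_on_subset[OF C\<theta>]]) (auto simp: W_def)
  have "\<forall>\<^sub>F x in nhds z. x \<in> ball z \<epsilon>' \<and> H x \<in> M \<and> H x \<in> ball z \<epsilon>' \<and>
      (\<Psi> (H x) \<in> V \<and> \<theta> (\<Psi> (H x)) = H x) \<and> (x, H x) \<in> U"
  proof (intro eventually_conj HM)
    show "\<forall>\<^sub>F x in nhds z. x \<in> ball z \<epsilon>'" using \<epsilon>'(1) by (intro eventually_nhds_in_open) auto
    show "\<forall>\<^sub>F x in nhds z. H x \<in> ball z \<epsilon>'"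
      by (rule topological_tendstoD[OF H_lim]) (use \<epsilon>'(1) in auto)
    show "\<forall>\<^sub>F x in nhds z. \<Psi> (H x) \<in> V" "\<forall>\<^sub>F x in nhds z. \<theta> (\<Psi> (H x)) = H x"
      using eventually_compose_filterlim[OF \<theta>\<Psi> H_lim] by (auto elim: eventually_mono)
    show "\<forall>\<^sub>F x in nhds z. (x, H x) \<in> U"
      by (rule topological_tendstoD[OF tendsto_Pair[OF filterlim_ident H_lim] U])
  qed
  then obtain S where S: "open S" "z \<in> S" and S':
    "\<And>x. x \<in> S \<Longrightarrow> x \<in> ball z \<epsilon>'" "\<And>x. x \<in> S \<Longrightarrow> H x \<in> M" "\<And>x. x \<in> S \<Longrightarrow> H x \<in> ball z \<epsilon>'"
    "\<And>x. x \<in> S \<Longrightarrow> h x \<in> V" "\<And>x. x \<in> S \<Longrightarrow> \<theta> (h x) = H x" "\<And>x. x \<in> S \<Longrightarrow> (x, H x) \<in> U"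
    unfolding eventually_nhds h_def by blast
  have lim\<theta>: "(\<theta> \<longlongrightarrow> H x) (nhds (h x))" if "x \<in> S" for x
  proof -
    have "isCont \<theta> (h x)" using cont\<theta> V(1) S'(4)[OF that] continuous_on_eq_continuous_at by blast
    then show ?thesis
      using tendsto_at_iff_tendsto_nhds[of \<theta> "h x"] S'(5)[OF that] by (simp add: isCont_def)
  qed
  have \<theta>M: "\<forall>\<^sub>F u in nhds (h x). u \<in> span B \<longrightarrow> \<theta> u \<in> M \<inter> ball z \<epsilon>'" if "x \<in> S" for x
  proof -
    have "\<forall>\<^sub>F u in nhds (h x). \<theta> u \<in> ball z \<epsilon>'"
      by (rule topological_tendstoD[OF lim\<theta>[OF that] open_ball S'(3)[OF that]])
    then show ?thesis
      using eventually_nhds_in_open[OF V(1) S'(4)[OF that]]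
    proof eventually_elim
      case (elim u)
      then show ?case using MB[of "\<theta> u"] \<epsilon>'(2) \<Psi>\<theta>[of u] by auto
    qed
  qed
  obtain \<delta> L where L: "\<delta> > 0" "L-lipschitz_on (ball z \<delta>) \<Psi>"
    using Ck_on_locally_lipschitz[OF open_UNIV UNIV_I \<Psi>] by metis
  \<comment> \<open>A Lipschitz constant may be 0; adding 1 allows the division by
    \<open>L'\<^sup>2\<close>.\<close>
  define L' where "L' = L + 1"
  have L': "L' > 0" "L' \<ge> L" using lipschitz_on_nonneg[OF L(2)] by (auto simp: L'_def)
  have hz: "h z = \<Psi> z" "\<theta> (h z) = z" using H(2) S'(5)[OF S(2)] by (simp_all add: h_def)
  have grow: "\<forall>\<^sub>F u in nhds (h z). u \<in> span B \<longrightarrow>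
      f (z, h z) + c / L'\<^sup>2 * (norm (u - h z))\<^sup>2 \<le> f (z, u)"
  proof -
    have lim: "(\<theta> \<longlongrightarrow> z) (nhds (h z))" using lim\<theta>[OF S(2)] H(2) by simp
    have "\<forall>\<^sub>F u in nhds (h z). \<theta> u \<in> ball z \<delta>"
      by (rule topological_tendstoD[OF lim]) (use L(1) in auto)
    with \<theta>M[OF S(2)] eventually_compose_filterlim[OF growth lim]
      eventually_nhds_in_open[OF V(1) S'(4)[OF S(2)]]
    show ?thesis
    proof eventually_elim
      case (elim u)
      have "c / L'\<^sup>2 * (norm (u - h z))\<^sup>2 \<le> c * (norm (\<theta> u - z))\<^sup>2"
      proof -
        have "norm (u - h z) \<le> L * norm (\<theta> u - z)"
          using lipschitz_onD[OF L(2), of "\<theta> u" z] elim L(1) \<Psi>\<theta>[of u] by (simp add: dist_norm hz(1))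
        also have "\<dots> \<le> L' * norm (\<theta> u - z)" using L'(2) by (intro mult_right_mono) auto
        finally have "(norm (u - h z))\<^sup>2 \<le> (L' * norm (\<theta> u - z))\<^sup>2" by (intro power_mono) auto
        then show ?thesis using L'(1) \<open>c > 0\<close> by (simp add: field_simps power_mult_distrib)
      qed
      then show ?case using elim hz(2) by (auto simp: f_def)
    qed
  qed
  have locmin: "\<forall>\<^sub>F u in nhds (h x). u \<in> span B \<longrightarrow> f (x, h x) \<le> f (x, u)" if "x \<in> S" for x
    using \<theta>M[OF that]
  proof eventually_elim
    case (elim u)
    show ?case
    proof
      assume "u \<in> span B"
      then have "\<sigma> (x, H x) \<le> \<sigma> (x, \<theta> u)"
        using elim S'(1-3)[OF that] \<epsilon>'(3) by (intro min) auto
      then show "f (x, h x) \<le> f (x, u)" by (simp add: f_def S'(5)[OF that])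
    qed
  qed
  have "continuous_on S h"
    unfolding h_def by (rule continuous_on_compose2[OF cont\<Psi> continuous_on_subset[OF H(1)]]) auto
  moreover have "(x, h x) \<in> W" if "x \<in> S" for x
    using S'(4-6)[OF that] by (simp add: W_def)
  moreover have "h x \<in> span B" if "x \<in> S" for x
    using MB[of "H x"] S'(2,3)[OF that] \<epsilon>'(2) by (auto simp: h_def)
  moreover have "c / L'\<^sup>2 > 0" using \<open>c > 0\<close> L'(1) by simp
  ultimately obtain T where T: "open T" "z \<in> T" "T \<subseteq> S" "Ck_on (Suc k) T h"
    using Ck_on_argmin_on_span[OF \<open>open W\<close> f S _ _ B _ locmin _ grow] by blast
  have "Ck_on (Suc k) T (\<lambda>x. \<theta> (h x))"
    by (rule Ck_on_compose[OF T(1) Ck_on_Suc_imp[OF \<theta>] T(4)]) (use S'(4) T(3) in auto)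
  then have "Ck_on (Suc k) T H"
    by (rule Ck_on_cong[OF T(1), rotated]) (use S'(5) T(3) in auto)
  then show ?thesis using that T(1,2) by blast
qed

section \<open>Anderson acceleration\<close>

lemma norm_linear_combination_le:
  fixes v :: "'i \<Rightarrow> 'a::real_normed_vector"
  assumes "(\<Sum>i\<in>I. \<bar>a i\<bar>) \<le> Q" "\<And>i. i \<in> I \<Longrightarrow> norm (v i) \<le> B" "B \<ge> 0"
  shows "norm (\<Sum>i\<in>I. a i *\<^sub>R v i) \<le> Q * B"
proof -
  have "norm (\<Sum>i\<in>I. a i *\<^sub>R v i) \<le> (\<Sum>i\<in>I. \<bar>a i\<bar> * B)"
    by (rule sum_norm_le) (simp add: assms(2) mult_left_mono)
  also have "\<dots> = (\<Sum>i\<in>I. \<bar>a i\<bar>) * B" by (simp add: sum_distrib_right)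
  also have "\<dots> \<le> Q * B" using assms(1,3) by (rule mult_right_mono)
  finally show ?thesis .
qed

lemma affine_combination_minus:
  fixes v :: "'i \<Rightarrow> 'a::real_normed_vector"
  assumes "(\<Sum>i\<in>I. a i) = 1"
  shows "(\<Sum>i\<in>I. a i *\<^sub>R (v i - z)) = (\<Sum>i\<in>I. a i *\<^sub>R v i) - z"
  by (simp add: scaleR_diff_right sum_subtractf assms flip: scaleR_left.sum)

text \<open>Near the fixed point error and residual are comparable. This lets the induction run on
  residuals and is the origin of the factor (1+\<gamma>)/(1-\<gamma>).\<close>

lemma contraction_residual_bounds:
  fixes H :: "'a::real_normed_vector \<Rightarrow> 'a"
  assumes "H z = z" "norm (H x - H z) \<le> \<gamma> * norm (x - z)"
  shows "(1 - \<gamma>) * norm (x - z) \<le> norm (H x - x)" "norm (H x - x) \<le> (1 + \<gamma>) * norm (x - z)"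
proof -
  have "norm (H x - z) \<le> \<gamma> * norm (x - z)" using assms by simp
  moreover have "norm (x - z) \<le> norm (H x - z) + norm (H x - x)"
    using norm_triangle_ineq4[of "H x - z" "H x - x"] by simp
  moreover have "norm (H x - x) \<le> norm (H x - z) + norm (x - z)"
    using norm_triangle_ineq4[of "H x - z" "x - z"] by simp
  ultimately show "(1 - \<gamma>) * norm (x - z) \<le> norm (H x - x)"
    "norm (H x - x) \<le> (1 + \<gamma>) * norm (x - z)" by (simp_all add: algebra_simps)
qed

text \<open>Putting all the weight on the newest iterate is admissible in the least-squares problem,
  so the optimal mixture is no worse than the current residual.\<close>

lemma anderson_mixed_residual_le:
  assumes "anderson m H x \<alpha>"
  shows "norm (\<Sum>i\<le>min m k. \<alpha> k i *\<^sub>R (H (x (k - min m k + i)) - x (k - min m k + i)))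
    \<le> norm (H (x k) - x k)"
proof -
  define q where "q = min m k"
  define r where "r j = H (x j) - x j" for j
  define \<beta> where "\<beta> i = (if i = q then 1 else 0 :: real)" for i
  have "(\<Sum>i\<le>q. \<beta> i) = 1" by (simp add: \<beta>_def)
  then have "(norm (\<Sum>i\<le>q. \<alpha> k i *\<^sub>R r (k - q + i)))\<^sup>2 \<le> (norm (\<Sum>i\<le>q. \<beta> i *\<^sub>R r (k - q + i)))\<^sup>2"
    using assms unfolding anderson_def Let_def q_def r_def by blast
  also have "(\<Sum>i\<le>q. \<beta> i *\<^sub>R r (k - q + i)) = (\<Sum>i\<le>q. if i = q then r (k - q + i) else 0)"
    by (intro sum.cong) (auto simp: \<beta>_def)
  also have "\<dots> = r k" by (simp add: q_def)
  finally show ?thesis unfolding q_def r_def by (rule power2_le_imp_le) simp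
qed

text \<open>With \<open>u = \<Sum> \<alpha>\<^sub>i x\<^sub>i\<close> and the mixed residual \<open>w = \<Sum> \<alpha>\<^sub>i r\<^sub>i\<close>, the next iterate is \<open>u + w\<close>.
  The contraction controls \<open>H (u + w) - H u\<close> by \<open>\<gamma> \<parallel>w\<parallel>\<close>, and in \<open>H u - \<Sum> \<alpha>\<^sub>i H x\<^sub>i\<close> the affine
  parts of the expansion of \<open>H\<close> at the fixed point cancel, leaving quadratic terms.\<close>

lemma anderson_residual_step:
  fixes H :: "'a::real_normed_vector \<Rightarrow> 'a"
  assumes run: "anderson m H x \<alpha>" and fp: "H z = z"
    and lip: "\<And>x y. x \<in> cball z \<rho> \<Longrightarrow> y \<in> cball z \<rho> \<Longrightarrow> norm (H x - H y) \<le> \<gamma> * norm (x - y)"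
    and "0 < \<gamma>" "\<gamma> < 1" and A: "linear A"
    and quad: "\<And>x. x \<in> cball z \<rho> \<Longrightarrow> norm (H x - z - A (x - z)) \<le> L * (norm (x - z))\<^sup>2"
    and "L \<ge> 0" and Q: "(\<Sum>i\<le>min m n. \<bar>\<alpha> n i\<bar>) \<le> Q" "Q \<ge> 1"
    and B: "\<And>i. i \<le> min m n \<Longrightarrow> norm (x (n - min m n + i) - z) \<le> B" "B \<ge> 0" "Q * B \<le> \<rho>"
  shows "norm (x (Suc n) - z) \<le> \<rho>"
    and "norm (H (x (Suc n)) - x (Suc n)) \<le> \<gamma> * norm (H (x n) - x n) + L * (Q\<^sup>2 + Q) * B\<^sup>2"
proof -
  define q where "q = min m n"
  define y where "y i = x (n - q + i)" for i
  define a where "a = \<alpha> n"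
  define u where "u = (\<Sum>i\<le>q. a i *\<^sub>R y i)"
  define w where "w = (\<Sum>i\<le>q. a i *\<^sub>R (H (y i) - y i))"
  have a1: "(\<Sum>i\<le>q. a i) = 1" and xS: "x (Suc n) = (\<Sum>i\<le>q. a i *\<^sub>R H (y i))"
    using run unfolding anderson_def Let_def a_def y_def q_def by auto
  have aQ: "(\<Sum>i\<le>q. \<bar>a i\<bar>) \<le> Q" using Q by (simp add: a_def q_def)
  have yB: "norm (y i - z) \<le> B" if "i \<le> q" for i
    using B(1) that by (simp add: y_def q_def)
  have "B \<le> Q * B" using \<open>Q \<ge> 1\<close> \<open>B \<ge> 0\<close> by (simp add: mult_le_cancel_right1)
  then have "B \<le> \<rho>" using B(3) by simp
  then have y\<rho>: "y i \<in> cball z \<rho>" if "i \<le> q" for i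
    using yB[OF that] by (simp add: dist_norm norm_minus_commute)
  have z\<rho>: "z \<in> cball z \<rho>" using \<open>B \<le> \<rho>\<close> \<open>B \<ge> 0\<close> by simp
  have Hy: "norm (H (y i) - z) \<le> B" if "i \<le> q" for i
  proof -
    have "norm (H (y i) - H z) \<le> \<gamma> * norm (y i - z)" by (rule lip[OF y\<rho>[OF that] z\<rho>])
    also have "\<dots> \<le> 1 * norm (y i - z)" using \<open>\<gamma> < 1\<close> by (intro mult_right_mono) auto
    finally show ?thesis using yB[OF that] fp by simp
  qed
  have "x (Suc n) - z = (\<Sum>i\<le>q. a i *\<^sub>R (H (y i) - z))"
    by (simp add: xS affine_combination_minus[OF a1])
  also have "norm \<dots> \<le> Q * B"
    by (rule norm_linear_combination_le[OF aQ _ B(2)]) (use Hy in auto)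
  finally show x\<rho>: "norm (x (Suc n) - z) \<le> \<rho>" using B(3) by simp
  have uz: "u - z = (\<Sum>i\<le>q. a i *\<^sub>R (y i - z))"
    by (simp add: u_def affine_combination_minus[OF a1])
  have uB: "norm (u - z) \<le> Q * B"
    unfolding uz by (rule norm_linear_combination_le[OF aQ _ B(2)]) (use yB in auto)
  then have u\<rho>: "u \<in> cball z \<rho>" using B(3) by (simp add: dist_norm norm_minus_commute)
  have "x (Suc n) - u = w"
    by (simp add: xS u_def w_def scaleR_diff_right sum_subtractf)
  then have "norm (H (x (Suc n)) - H u) \<le> \<gamma> * norm w"
    using lip[of "x (Suc n)" u] u\<rho> x\<rho> by (simp add: dist_norm norm_minus_commute)
  also have "norm w \<le> norm (H (x n) - x n)"
    using anderson_mixed_residual_le[OF run, of n] by (simp add: w_def a_def y_def q_def)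
  finally have 1: "norm (H (x (Suc n)) - H u) \<le> \<gamma> * norm (H (x n) - x n)"
    using \<open>\<gamma> > 0\<close> by simp
  define d where "d p = H p - z - A (p - z)" for p
  have "A (u - z) = (\<Sum>i\<le>q. a i *\<^sub>R A (y i - z))"
    unfolding uz by (simp only: linear_sum[OF A] linear_scale[OF A])
  then have "(\<Sum>i\<le>q. a i *\<^sub>R d (y i)) = (\<Sum>i\<le>q. a i *\<^sub>R (H (y i) - z)) - A (u - z)"
    by (simp add: d_def scaleR_diff_right[of _ _ "A _"] sum_subtractf)
  also have "(\<Sum>i\<le>q. a i *\<^sub>R (H (y i) - z)) = x (Suc n) - z"
    by (simp add: xS affine_combination_minus[OF a1])
  finally have "H u - x (Suc n) = d u - (\<Sum>i\<le>q. a i *\<^sub>R d (y i))"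
    by (simp add: d_def)
  also have "norm \<dots> \<le> norm (d u) + norm (\<Sum>i\<le>q. a i *\<^sub>R d (y i))"
    by (rule norm_triangle_ineq4)
  also have "norm (d u) \<le> L * (Q * B)\<^sup>2"
  proof -
    have "norm (d u) \<le> L * (norm (u - z))\<^sup>2" unfolding d_def by (rule quad[OF u\<rho>])
    also have "\<dots> \<le> L * (Q * B)\<^sup>2" using uB \<open>L \<ge> 0\<close> by (intro mult_left_mono power_mono) auto
    finally show ?thesis .
  qed
  also have "norm (\<Sum>i\<le>q. a i *\<^sub>R d (y i)) \<le> Q * (L * B\<^sup>2)"
  proof (rule norm_linear_combination_le[OF aQ])
    fix i assume "i \<in> {..q}"
    then have "norm (d (y i)) \<le> L * (norm (y i - z))\<^sup>2" unfolding d_def by (intro quad y\<rho>) auto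
    also have "\<dots> \<le> L * B\<^sup>2"
      using yB[of i] \<open>i \<in> {..q}\<close> \<open>L \<ge> 0\<close> by (intro mult_left_mono power_mono) auto
    finally show "norm (d (y i)) \<le> L * B\<^sup>2" .
  qed (use \<open>L \<ge> 0\<close> in simp)
  \<comment> \<open>\<open>Q\<^sup>2\<close> comes from the remainder at \<open>u\<close>, which is
    within \<open>Q * B\<close> of the fixed point; \<open>Q\<close> comes from the weighted
    remainders at the stored iterates.\<close>
  finally have 2: "norm (H u - x (Suc n)) \<le> L * (Q\<^sup>2 + Q) * B\<^sup>2"
    by (simp add: algebra_simps power_mult_distrib)
  show "norm (H (x (Suc n)) - x (Suc n)) \<le> \<gamma> * norm (H (x n) - x n) + L * (Q\<^sup>2 + Q) * B\<^sup>2"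
    using norm_triangle_ineq[of "H (x (Suc n)) - H u" "H u - x (Suc n)"] 1 2 by simp
qed

text \<open>The residual step has slack g - \<gamma> per iteration, and the quadratic term has to
  fit into it. One factor \<open>R\<close> of that term is made small by \<delta>, which is fixed
  before the run and its coefficients.\<close>

lemma anderson_r_linear:
  fixes H :: "'a::real_normed_vector \<Rightarrow> 'a"
  assumes fp: "H z = z"
    and lip: "\<And>x y. x \<in> cball z \<rho> \<Longrightarrow> y \<in> cball z \<rho> \<Longrightarrow> norm (H x - H y) \<le> \<gamma> * norm (x - y)"
    and \<gamma>: "0 < \<gamma>" "\<gamma> < 1" and "\<rho> > 0" and A: "linear A"
    and quad: "\<And>x. x \<in> cball z \<rho> \<Longrightarrow> norm (H x - z - A (x - z)) \<le> L * (norm (x - z))\<^sup>2"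
    and g: "\<gamma> < g" "g < 1"
  obtains \<delta> where "\<delta> > 0" "\<And>x \<alpha>. anderson m H x \<alpha> \<Longrightarrow> norm (x 0 - z) \<le> \<delta> \<Longrightarrow>
      (\<And>k. (\<Sum>i\<le>min m k. \<bar>\<alpha> k i\<bar>) \<le> M) \<Longrightarrow>
      x \<longlonglongrightarrow> z \<and> (\<forall>k. norm (H (x k) - x k) \<le> g ^ k * norm (H (x 0) - x 0) \<and>
        norm (x k - z) \<le> (1 + \<gamma>) / (1 - \<gamma>) * g ^ k * norm (x 0 - z))"
proof -
  \<comment> \<open>This makes \<open>Q \<ge> 1\<close> whatever \<open>M\<close> is. In
    \<open>K\<close>, the square of 1-\<gamma> converts two error factors into residuals, and
    \<open>\<bar>L\<bar> + 1\<close> keeps \<open>K\<close> positive.\<close>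
  define Q where "Q = \<bar>M\<bar> + 1"
  define K where "K = (\<bar>L\<bar> + 1) * (Q\<^sup>2 + Q) / (1 - \<gamma>)\<^sup>2"
  \<comment> \<open>The first entry keeps mixtures of the iterates inside the ball of radius \<rho>;
    the second makes \<open>K * R\<close> at most \<open>(g - \<gamma>) * g ^ m\<close>.\<close>
  define \<delta> where "\<delta> = min (\<rho> * (1 - \<gamma>) / ((1 + \<gamma>) * Q)) ((g - \<gamma>) * g ^ m / (K * (1 + \<gamma>)))"
  have "Q \<ge> 1" by (simp add: Q_def)
  have "g > 0" using g \<gamma> by simp
  have "K > 0"
    unfolding K_def using \<gamma> \<open>Q \<ge> 1\<close>
    by (intro divide_pos_pos mult_pos_pos add_nonneg_pos add_pos_pos zero_less_power) auto
  have \<delta>: "\<delta> > 0" "Q * ((1 + \<gamma>) / (1 - \<gamma>) * \<delta>) \<le> \<rho>" "K * ((1 + \<gamma>) * \<delta>) \<le> (g - \<gamma>) * g ^ m"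
  proof -
    show "\<delta> > 0" using \<gamma> g \<open>Q \<ge> 1\<close> \<open>K > 0\<close> \<open>\<rho> > 0\<close> \<open>g > 0\<close> by (simp add: \<delta>_def)
    have "\<delta> \<le> \<rho> * (1 - \<gamma>) / ((1 + \<gamma>) * Q)" unfolding \<delta>_def by (rule min.cobounded1)
    then have "\<delta> * ((1 + \<gamma>) * Q) \<le> \<rho> * (1 - \<gamma>)"
      using \<gamma> \<open>Q \<ge> 1\<close> by (simp add: pos_le_divide_eq)
    then show "Q * ((1 + \<gamma>) / (1 - \<gamma>) * \<delta>) \<le> \<rho>" using \<gamma> by (simp add: field_simps)
    have "\<delta> \<le> (g - \<gamma>) * g ^ m / (K * (1 + \<gamma>))" unfolding \<delta>_def by (rule min.cobounded2)
    then show "K * ((1 + \<gamma>) * \<delta>) \<le> (g - \<gamma>) * g ^ m"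
      using \<gamma> \<open>K > 0\<close> by (simp add: pos_le_divide_eq mult_ac)
  qed
  have quad': "norm (H x - z - A (x - z)) \<le> \<bar>L\<bar> * (norm (x - z))\<^sup>2" if "x \<in> cball z \<rho>" for x
    using quad[OF that] mult_right_mono[OF abs_ge_self[of L], of "(norm (x - z))\<^sup>2"] by simp
  have res: "(1 - \<gamma>) * norm (p - z) \<le> norm (H p - p)" "norm (H p - p) \<le> (1 + \<gamma>) * norm (p - z)"
    if "norm (p - z) \<le> \<rho>" for p
    using contraction_residual_bounds[OF fp lip[of p z]] that \<open>\<rho> > 0\<close>
    by (simp_all add: dist_norm norm_minus_commute)
  show ?thesis
  proof (rule that[OF \<delta>(1)])
    fix x :: "nat \<Rightarrow> 'a" and \<alpha> :: "nat \<Rightarrow> nat \<Rightarrow> real"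
    assume run: "anderson m H x \<alpha>" and x0: "norm (x 0 - z) \<le> \<delta>"
      and M: "\<And>k. (\<Sum>i\<le>min m k. \<bar>\<alpha> k i\<bar>) \<le> M"
    have aQ: "(\<Sum>i\<le>min m k. \<bar>\<alpha> k i\<bar>) \<le> Q" for k using M[of k] by (simp add: Q_def)
    define R where "R = norm (H (x 0) - x 0)"
    have "\<delta> \<le> (1 + \<gamma>) / (1 - \<gamma>) * \<delta>"
      using \<gamma> \<delta>(1) by (simp add: field_simps)
    also have "\<dots> \<le> Q * ((1 + \<gamma>) / (1 - \<gamma>) * \<delta>)"
      using mult_right_mono[OF \<open>Q \<ge> 1\<close>, of "(1 + \<gamma>) / (1 - \<gamma>) * \<delta>"] \<gamma> \<delta>(1) by simp
    finally have x0\<rho>: "norm (x 0 - z) \<le> \<rho>" using \<delta>(2) x0 by simp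
    have "R \<ge> 0" by (simp add: R_def)
    have "R \<le> (1 + \<gamma>) * norm (x 0 - z)" unfolding R_def by (rule res(2)[OF x0\<rho>])
    also have "\<dots> \<le> (1 + \<gamma>) * \<delta>" using x0 \<gamma> by simp
    finally have R\<delta>: "R \<le> (1 + \<gamma>) * \<delta>" .
    define \<eta> where "\<eta> = R / (1 - \<gamma>)"
    have "\<eta> \<ge> 0" using \<open>R \<ge> 0\<close> \<gamma> by (simp add: \<eta>_def)
    have "\<eta> \<le> (1 + \<gamma>) / (1 - \<gamma>) * \<delta>" using R\<delta> \<gamma> by (simp add: \<eta>_def divide_right_mono)
    then have "Q * \<eta> \<le> Q * ((1 + \<gamma>) / (1 - \<gamma>) * \<delta>)" using \<open>Q \<ge> 1\<close> by (intro mult_left_mono) auto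
    then have "Q * \<eta> \<le> \<rho>" using \<delta>(2) by simp
    have KR: "K * R \<le> (g - \<gamma>) * g ^ m"
      by (rule order_trans[OF mult_left_mono[OF R\<delta> less_imp_le[OF \<open>K > 0\<close>]] \<delta>(3)])
    have e_le: "norm (x k - z) \<le> g ^ k * \<eta>"
      if "norm (x k - z) \<le> \<rho>" "norm (H (x k) - x k) \<le> g ^ k * R" for k
      using res(1)[OF that(1)] that(2) \<gamma> by (simp add: \<eta>_def field_simps)
    \<comment> \<open>Complete induction, because one step reaches back over the whole memory
      window. Membership in the ball is carried along so that the local estimates stay
      applicable.\<close>
    have P: "norm (x k - z) \<le> \<rho> \<and> norm (H (x k) - x k) \<le> g ^ k * R" for k
    proof (induction k rule: less_induct)
      case (less k)
      show ?case
      proof (cases k)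
        case 0
        then show ?thesis using x0\<rho> by (simp add: R_def)
      next
        case (Suc n)
        define q where "q = min m n"
        \<comment> \<open>The bound for the oldest error in the window; as \<open>g < 1\<close>, it
          serves for all of them.\<close>
        define B where "B = g ^ (n - q) * \<eta>"
        have "B \<ge> 0" using \<open>g > 0\<close> \<open>\<eta> \<ge> 0\<close> by (simp add: B_def)
        have "B \<le> 1 * \<eta>"
          unfolding B_def using \<open>g > 0\<close> \<open>\<eta> \<ge> 0\<close> g by (intro mult_right_mono power_le_one) auto
        then have "Q * B \<le> Q * \<eta>" using \<open>Q \<ge> 1\<close> by (intro mult_left_mono) auto
        then have QB: "Q * B \<le> \<rho>" using \<open>Q * \<eta> \<le> \<rho>\<close> by simp
        have eB: "norm (x (n - q + i) - z) \<le> B" if "i \<le> q" for i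
        proof -
          have "n - q + i < k" using that Suc unfolding q_def by linarith
          then have "norm (x (n - q + i) - z) \<le> g ^ (n - q + i) * \<eta>"
            using less.IH e_le by blast
          also have "\<dots> \<le> B"
            unfolding B_def using \<open>g > 0\<close> \<open>\<eta> \<ge> 0\<close> g
            by (intro mult_right_mono power_decreasing) auto
          finally show ?thesis .
        qed
        note step = anderson_residual_step[OF run fp lip \<gamma> A quad' abs_ge_zero aQ \<open>Q \<ge> 1\<close>
            eB[unfolded q_def] \<open>B \<ge> 0\<close> QB]
        have "\<bar>L\<bar> * (Q\<^sup>2 + Q) * B\<^sup>2 \<le> (\<bar>L\<bar> + 1) * (Q\<^sup>2 + Q) * B\<^sup>2"
          using \<open>Q \<ge> 1\<close> by (intro mult_right_mono) auto
        also have "\<dots> = K * R * (g ^ (n - q) * g ^ (n - q)) * R"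
          using \<gamma> by (simp add: K_def B_def \<eta>_def field_simps power2_eq_square)
        also have "\<dots> \<le> (g - \<gamma>) * g ^ m * (g ^ (n - q) * g ^ (n - q)) * R"
          using KR \<open>R \<ge> 0\<close> \<open>g > 0\<close> by (intro mult_right_mono) auto
        also have "\<dots> = (g - \<gamma>) * g ^ (m + ((n - q) + (n - q))) * R"
          by (simp add: power_add)
        also have "\<dots> \<le> (g - \<gamma>) * g ^ n * R"
        proof -
          \<comment> \<open>A full window has q = m \<le> n, so the right-hand side is 2n - m; in
            the starting phase q = n \<le> m, so it is m. Both are at least n, and the factor
            \<open>g ^ m\<close> from \<delta> makes up for the age of the window.\<close>
          have "n \<le> m + ((n - q) + (n - q))" by (simp add: q_def)
          then show ?thesis
            using \<open>R \<ge> 0\<close> \<open>g > 0\<close> g by (intro mult_right_mono mult_left_mono power_decreasing) auto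
        qed
        finally have quadratic: "\<bar>L\<bar> * (Q\<^sup>2 + Q) * B\<^sup>2 \<le> (g - \<gamma>) * g ^ n * R" .
        have "\<gamma> * norm (H (x n) - x n) \<le> \<gamma> * (g ^ n * R)"
          using less.IH[of n] Suc \<gamma> by simp
        with quadratic step(2) have "norm (H (x k) - x k) \<le> g ^ k * R"
          unfolding Suc by (simp add: algebra_simps)
        then show ?thesis using step(1) unfolding Suc by simp
      qed
    qed
    have final: "norm (x k - z) \<le> (1 + \<gamma>) / (1 - \<gamma>) * g ^ k * norm (x 0 - z)" for k
    proof -
      have "norm (x k - z) \<le> g ^ k * \<eta>" using P e_le by blast
      also have "\<eta> \<le> (1 + \<gamma>) * norm (x 0 - z) / (1 - \<gamma>)"
        unfolding \<eta>_def using res(2)[OF x0\<rho>] \<gamma> by (simp add: R_def divide_right_mono)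
      finally show ?thesis using \<open>g > 0\<close> by (simp add: mult_ac)
    qed
    have "(\<lambda>k. (1 + \<gamma>) / (1 - \<gamma>) * g ^ k * norm (x 0 - z)) \<longlonglongrightarrow> (1 + \<gamma>) / (1 - \<gamma>) * 0 * norm (x 0 - z)"
      using \<open>g > 0\<close> g by (intro tendsto_intros LIMSEQ_power_zero) auto
    then have "(\<lambda>k. x k - z) \<longlonglongrightarrow> 0"
      unfolding mult_zero_right mult_zero_left
      by (rule Lim_null_comparison[OF always_eventually[OF allI[OF final]]])
    then have "x \<longlonglongrightarrow> z" by (rule LIM_zero_cancel)
    then show "x \<longlonglongrightarrow> z \<and> (\<forall>k. norm (H (x k) - x k) \<le> g ^ k * norm (H (x 0) - x 0) \<and>
        norm (x k - z) \<le> (1 + \<gamma>) / (1 - \<gamma>) * g ^ k * norm (x 0 - z))"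
      using P final by (simp add: R_def)
  qed
qed

text \<open>The rate and the radius \<delta> are chosen after \<rho>, \<gamma>,
  \<open>M\<^sub>\<alpha>\<close> and \<open>m\<close> but before the run and its coefficients, so
  the estimate covers every choice of minimizing coefficients that obeys the bound.\<close>

theorem theorem2p8:
  fixes F :: "real ^ 'n \<Rightarrow> ereal"
    and s :: "real ^ 'n \<Rightarrow> real ^ 'n \<Rightarrow> ereal"
    and H :: "real ^ 'n \<Rightarrow> real ^ 'n"
    and M :: "(real ^ 'n) set"
    and xstar :: "real ^ 'n"
    and xseq :: "nat \<Rightarrow> real ^ 'n"
  assumes F_proper: "\<And>x. F x \<noteq> -\<infinity>"
    and F_closed: "closed (epi F)"
    and F_level_bounded: "level_bounded F"
    and critical: "0 \<in> clarke_subdiff F xstar"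
    and active: "admits_active_manifold 3 F M xstar"
    and s_proper: "\<And>x y. s x y \<noteq> -\<infinity>"
    and seq_step: "\<And>k. xseq (Suc k) = H (xseq k)"
    and seq_lim: "xseq \<longlonglongrightarrow> xstar"
    and H_cont: "continuous_on UNIV H"
    and smooth: "\<exists>shat :: (real ^ 'n) \<times> (real ^ 'n) \<Rightarrow> real. \<exists>U \<epsilon>.
          open U \<and> (xstar, xstar) \<in> U \<and> Ck_on 3 U shat \<and> \<epsilon> > 0 \<and>
          (\<forall>x \<in> ball xstar \<epsilon>. \<forall>y \<in> M \<inter> ball xstar \<epsilon>. ereal (shat (x, y)) = s x y)"
    and H_argmin: "\<And>x. argmin_set (s x) = {H x}"
    and H_strong: "\<And>x. strong_minimizer (s x) (H x)"
    and identify: "\<forall>\<^sub>F x in nhds xstar. H x \<in> M"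
  shows "(\<exists>\<epsilon>>0.
            Ck_on 2 (ball xstar \<epsilon>) H \<and>
            (\<exists>L. L-lipschitz_on (ball xstar \<epsilon>) H) \<and>
            (\<exists>L. L-lipschitz_on (ball xstar \<epsilon>) (\<lambda>x. jacobian H (at x))))
       \<and> (\<forall>\<rho> \<gamma> M\<^sub>\<alpha> :: real. \<forall>m :: nat.
            \<rho> > 0 \<and> 0 < \<gamma> \<and> \<gamma> < 1 \<and> m \<ge> 1 \<and>
            (\<forall>x \<in> cball xstar \<rho>. \<forall>y \<in> cball xstar \<rho>. norm (H x - H y) \<le> \<gamma> * norm (x - y))
            \<longrightarrow>
            (\<exists>\<gamma>hat. \<gamma> < \<gamma>hat \<and> \<gamma>hat < 1 \<and>
              (\<exists>\<delta>>0. \<forall>x \<alpha>.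
                 anderson m H x \<alpha> \<and> norm (x 0 - xstar) \<le> \<delta> \<and>
                 (\<forall>k. (\<Sum>i\<le>min m k. \<bar>\<alpha> k i\<bar>) \<le> M\<^sub>\<alpha>)
                 \<longrightarrow>
                 x \<longlonglongrightarrow> xstar \<and>
                 (\<forall>k. norm (H (x k) - x k) \<le> \<gamma>hat ^ k * norm (H (x 0) - x 0) \<and>
                      norm (x k - xstar) \<le> (1 + \<gamma>) / (1 - \<gamma>) * \<gamma>hat ^ k * norm (x 0 - xstar)))))"
proof -
  \<comment> \<open>Both sides of \<open>xseq (Suc k) = H (xseq k)\<close> converge, and continuity
    of \<open>H\<close> identifies the limits.\<close>
  have H_fix: "H xstar = xstar"
  proof -
    have "(\<lambda>k. H (xseq k)) \<longlonglongrightarrow> H xstar"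
      by (rule continuous_on_tendsto_compose[OF H_cont seq_lim]) auto
    moreover have "(\<lambda>k. H (xseq k)) \<longlonglongrightarrow> xstar"
      using LIMSEQ_Suc[OF seq_lim] by (simp add: seq_step)
    ultimately show ?thesis by (rule LIMSEQ_unique)
  qed
  obtain r G where manifold: "manifold_around 3 r M xstar G"
    using active unfolding admits_active_manifold_def by blast
  define q where "q = CARD('n) - r"
  obtain \<epsilon>\<^sub>M where "\<epsilon>\<^sub>M > 0"
    and M: "M \<inter> ball xstar \<epsilon>\<^sub>M = {y \<in> ball xstar \<epsilon>\<^sub>M. \<forall>i<q. G i y = 0}" "xstar \<in> M"
    and G: "\<And>i. i < q \<Longrightarrow> Ck_on (Suc (Suc 1)) UNIV (G i)" and rank: "full_row_rank_at q G xstar"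
    using manifold unfolding manifold_around_def q_def by (auto simp: numeral_3_eq_3)
  obtain shat U \<epsilon>\<^sub>s where U: "open U" "(xstar, xstar) \<in> U" and shat: "Ck_on (Suc (Suc 1)) U shat"
    and "\<epsilon>\<^sub>s > 0"
    and s_eq: "\<And>x y. x \<in> ball xstar \<epsilon>\<^sub>s \<Longrightarrow> y \<in> M \<inter> ball xstar \<epsilon>\<^sub>s \<Longrightarrow> s x y = ereal (shat (x, y))"
    using smooth by (auto simp: numeral_3_eq_3)
  have min: "shat (x, H x) \<le> shat (x, y)"
    if "x \<in> ball xstar \<epsilon>\<^sub>s" "H x \<in> M \<inter> ball xstar \<epsilon>\<^sub>s" "y \<in> M \<inter> ball xstar \<epsilon>\<^sub>s" for x y
  proof -
    have "s x (H x) \<le> s x y" using H_argmin[of x] by (auto simp: argmin_set_def)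
    then show ?thesis using s_eq that by simp
  qed
  obtain c where "c > 0"
    and c: "\<forall>\<^sub>F y in nhds xstar. s xstar y \<ge> s xstar xstar + ereal (c * (norm (y - xstar))\<^sup>2)"
    using H_strong[of xstar] H_fix by (auto simp: strong_minimizer_def)
  have near: "\<forall>\<^sub>F y in nhds xstar. y \<in> ball xstar \<epsilon>\<^sub>s"
    using \<open>\<epsilon>\<^sub>s > 0\<close> by (intro eventually_nhds_in_open) auto
  from c near have growth: "\<forall>\<^sub>F y in nhds xstar. y \<in> M \<longrightarrow>
      shat (xstar, xstar) + c * (norm (y - xstar))\<^sup>2 \<le> shat (xstar, y)"
  proof eventually_elim
    case (elim y)
    then show ?case
      using s_eq[of xstar y] s_eq[of xstar xstar] \<open>\<epsilon>\<^sub>s > 0\<close> M(2) by auto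
  qed
  \<comment> \<open>The instance k = 1: data of order 3 give a map of order 2.\<close>
  obtain T where T: "open T" "xstar \<in> T" and "Ck_on (Suc 1) T H"
    by (rule Ck_on_argmin_on_manifold[OF G rank \<open>\<epsilon>\<^sub>M > 0\<close> M U shat H_cont H_fix identify
          \<open>\<epsilon>\<^sub>s > 0\<close> min \<open>c > 0\<close> growth]) blast+
  then have H2: "Ck_on 2 T H" and H1: "Ck_on (Suc 0) T H" and HSS: "Ck_on (Suc (Suc 0)) T H"
    by (simp_all only: numeral_2_eq_2 One_nat_def Ck_on_Suc_imp)
  show ?thesis
  proof (intro conjI allI impI)
    obtain e0 where e0: "e0 > 0" "ball xstar e0 \<subseteq> T" using T open_contains_ball by blast
    obtain e1 L1 where e1: "e1 > 0" "L1-lipschitz_on (ball xstar e1) H"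
      using Ck_on_locally_lipschitz[OF T H1] by metis
    obtain e2 L2 where e2: "e2 > 0" "L2-lipschitz_on (ball xstar e2) (\<lambda>x. jacobian H (at x))"
      using Ck_on_locally_lipschitz[OF T Ck_on_jacobian[OF T(1) HSS]] by metis
    define \<epsilon> where "\<epsilon> = min e0 (min e1 e2)"
    show "\<exists>\<epsilon>>0. Ck_on 2 (ball xstar \<epsilon>) H \<and> (\<exists>L. L-lipschitz_on (ball xstar \<epsilon>) H) \<and>
        (\<exists>L. L-lipschitz_on (ball xstar \<epsilon>) (\<lambda>x. jacobian H (at x)))"
    proof (rule exI[of _ \<epsilon>], intro conjI)
      show "\<epsilon> > 0" using e0 e1 e2 by (simp add: \<epsilon>_def)
      show "Ck_on 2 (ball xstar \<epsilon>) H" using e0(2) by (intro Ck_on_subset[OF H2]) (auto simp: \<epsilon>_def)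
      show "\<exists>L. L-lipschitz_on (ball xstar \<epsilon>) H"
        by (rule exI[of _ L1], rule lipschitz_on_subset[OF e1(2)]) (auto simp: \<epsilon>_def)
      show "\<exists>L. L-lipschitz_on (ball xstar \<epsilon>) (\<lambda>x. jacobian H (at x))"
        by (rule exI[of _ L2], rule lipschitz_on_subset[OF e2(2)]) (auto simp: \<epsilon>_def)
    qed
  next
    fix \<rho> \<gamma> M\<^sub>\<alpha> :: real and m :: nat
    assume *: "\<rho> > 0 \<and> 0 < \<gamma> \<and> \<gamma> < 1 \<and> m \<ge> 1 \<and>
      (\<forall>x \<in> cball xstar \<rho>. \<forall>y \<in> cball xstar \<rho>. norm (H x - H y) \<le> \<gamma> * norm (x - y))"
    obtain e L where e: "e > 0" "\<And>x. x \<in> cball xstar e \<Longrightarrow>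
        norm (H x - H xstar - frechet_derivative H (at xstar) (x - xstar)) \<le> L * (norm (x - xstar))\<^sup>2"
      using Ck_on_2_quadratic_remainder[OF T H2] by metis
    \<comment> \<open>The contraction holds on radius \<rho>, the Taylor bound on radius
      \<open>e\<close>; the acceleration estimate needs both on one ball.\<close>
    define \<rho>' where "\<rho>' = min \<rho> e"
    have \<rho>': "\<rho>' > 0" "cball xstar \<rho>' \<subseteq> cball xstar \<rho>" "cball xstar \<rho>' \<subseteq> cball xstar e"
      using * e(1) by (auto simp: \<rho>'_def)
    \<comment> \<open>Any number strictly between \<gamma> and 1 would serve; the midpoint is
      taken.\<close>
    define g where "g = (1 + \<gamma>) / 2"
    have g: "\<gamma> < g" "g < 1" using * by (auto simp: g_def)
    have lip: "norm (H x - H y) \<le> \<gamma> * norm (x - y)" if "x \<in> cball xstar \<rho>'" "y \<in> cball xstar \<rho>'" for x y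
      using * that \<rho>'(2) by blast
    have quad: "norm (H x - xstar - frechet_derivative H (at xstar) (x - xstar)) \<le> L * (norm (x - xstar))\<^sup>2"
      if "x \<in> cball xstar \<rho>'" for x
      using e(2)[of x] that \<rho>'(3) H_fix by auto
    have lin: "linear (frechet_derivative H (at xstar))"
      using Ck_on_SucD(1)[OF H1 T(2)] by (rule has_derivative_linear)
    obtain \<delta> where \<delta>: "\<delta> > 0" "\<And>x \<alpha>. anderson m H x \<alpha> \<Longrightarrow> norm (x 0 - xstar) \<le> \<delta> \<Longrightarrow>
        (\<And>k. (\<Sum>i\<le>min m k. \<bar>\<alpha> k i\<bar>) \<le> M\<^sub>\<alpha>) \<Longrightarrow>
        x \<longlonglongrightarrow> xstar \<and> (\<forall>k. norm (H (x k) - x k) \<le> g ^ k * norm (H (x 0) - x 0) \<and>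
          norm (x k - xstar) \<le> (1 + \<gamma>) / (1 - \<gamma>) * g ^ k * norm (x 0 - xstar))"
      using anderson_r_linear[OF H_fix lip _ _ \<rho>'(1) lin quad g, of m M\<^sub>\<alpha>] * by blast
    show "\<exists>\<gamma>hat. \<gamma> < \<gamma>hat \<and> \<gamma>hat < 1 \<and>
        (\<exists>\<delta>>0. \<forall>x \<alpha>. anderson m H x \<alpha> \<and> norm (x 0 - xstar) \<le> \<delta> \<and>
          (\<forall>k. (\<Sum>i\<le>min m k. \<bar>\<alpha> k i\<bar>) \<le> M\<^sub>\<alpha>) \<longrightarrow>
          x \<longlonglongrightarrow> xstar \<and> (\<forall>k. norm (H (x k) - x k) \<le> \<gamma>hat ^ k * norm (H (x 0) - x 0) \<and>
            norm (x k - xstar) \<le> (1 + \<gamma>) / (1 - \<gamma>) * \<gamma>hat ^ k * norm (x 0 - xstar)))"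
      using g \<delta> by blast
  qed
qed

end
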